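(* Let $\mathcal{H}_1,\mathcal{H}_2$ be separable complex Hilbert spaces, $\mathcal{H}=\mathcal{H}_1\otimes\mathcal{H}_2$, and let $(X,\mu)=(X_1\times X_2,\mu_1\otimes\mu_2)$ be the product of measure spaces with $\sigma$-finite positive measures $\mu_1,\mu_2$. (i) Let $F:X\to\mathcal{H}$ be a Bessel mapping. Then the synthesis operator $T_F:L^2(X,\mu)\to\mathcal{H}$, $T_F\varphi=\int_X\varphi(x)F(x)\,d\mu(x)$ (weak sense), is a well-defined, linear and bounded operator, and its adjoint $T_F^*:\mathcal{H}\to L^2(X,\mu)$ is given by $(T_F^*f)(x)=\langle f,F(x)\rangle$, $x\in X$. (ii) Let $F_1,F_2$ be continuous frames for $\mathcal{H}_1,\mathcal{H}_2$ with respect to $(X_1,\mu_1),(X_2,\mu_2)$, so that $F=F_1\otimes F_2$ is a continuous frame for $\mathcal{H}$ with respect to $(X,\mu)$. Then for $f_1\in\mathcal{H}_1$, $f_2\in\mathcal{H}_2$, $$(T_F^*(f_1\otimes f_2))(x_1,x_2)=\langle f_1,F_1(x_1)\rangle\langle f_2,F_2(x_2)\rangle ;$$ the continuous frame operator $S_F=T_FT_F^*$ satisfies $$S_{F_1\otimes F_2}=S_{F_1}\otimes S_{F_2};$$ and the canonical dual frame of $F=F_1\otimes F_2$ is $G=S_{F_1}^{-1}F_1\otimes S_{F_2}^{-1}F_2$.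
   Context: $\mathcal{H}_1\otimes\mathcal{H}_2$ is the Hilbert space tensor product; $(F_1\otimes F_2)(x_1,x_2)=F_1(x_1)\otimes F_2(x_2)$; for bounded operators $S$ on $\mathcal{H}_1$ and $T$ on $\mathcal{H}_2$, $S\otimes T$ is the bounded operator on $\mathcal{H}_1\otimes\mathcal{H}_2$ with $(S\otimes T)(u\otimes v)=Su\otimes Tv$. A weakly measurable mapping $F:X\to\mathcal{K}$ (i.e. $x\mapsto\langle f,F(x)\rangle$ is measurable for every $f$) into a separable Hilbert space $\mathcal{K}$ is a continuous frame for $\mathcal{K}$ with respect to $(X,\mu)$ if there are $A>0$, $B<\infty$ with $A\|f\|^2\le\int_X|\langle f,F(x)\rangle|^2d\mu(x)\le B\|f\|^2$ for all $f\in\mathcal{K}$; it is a Bessel mapping if only the upper inequality is required. For a Bessel mapping $F$, the frame operator is $S_F=T_FT_F^*$; it is bounded, and boundedly invertible when $F$ is a continuous frame. The canonical dual frame of a continuous frame $F$ is $x\mapsto S_F^{-1}F(x)$. *)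

theory Defs
  imports "HOL-Analysis.Analysis"
begin

section \<open>Complex Hilbert spaces\<close>

text \<open>The inner product is linear in the first and conjugate-linear in the second argument.
  Its positive definiteness is contained in the last axiom.\<close>

class complex_inner = real_normed_vector +
  fixes scaleC :: "complex \<Rightarrow> 'a \<Rightarrow> 'a" (infixr "*\<^sub>C" 75)
    and cinner :: "'a \<Rightarrow> 'a \<Rightarrow> complex"
  assumes scaleC_add_right: "c *\<^sub>C (x + y) = c *\<^sub>C x + c *\<^sub>C y"
    and scaleC_add_left: "(c + d) *\<^sub>C x = c *\<^sub>C x + d *\<^sub>C x"
    and scaleC_scaleC: "c *\<^sub>C d *\<^sub>C x = (c * d) *\<^sub>C x"
    and scaleR_scaleC: "r *\<^sub>R x = complex_of_real r *\<^sub>C x"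
    and cinner_commute: "cinner x y = cnj (cinner y x)"
    and cinner_add_left: "cinner (x + y) z = cinner x z + cinner y z"
    and cinner_scaleC_left: "cinner (c *\<^sub>C x) y = c * cinner x y"
    and cinner_self: "cinner x x = complex_of_real ((norm x)\<^sup>2)"

class chilbert_space = complex_inner + complete_space
begin
subclass banach ..
end

instantiation complex :: chilbert_space
begin
definition scaleC_complex :: "complex \<Rightarrow> complex \<Rightarrow> complex" where
  "scaleC_complex c x = c * x"
definition cinner_complex :: "complex \<Rightarrow> complex \<Rightarrow> complex" where
  "cinner_complex x y = x * cnj y"
instance
proof
  fix x :: complex
  show "cinner x x = complex_of_real ((norm x)\<^sup>2)"
    unfolding cinner_complex_def by (rule complex_norm_square[symmetric])
qed (simp_all add: scaleC_complex_def cinner_complex_def distrib_left distrib_right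
    mult.assoc mult.commute scaleR_conv_of_real)
end

definition bounded_clinear :: "('a::complex_inner \<Rightarrow> 'b::complex_inner) \<Rightarrow> bool" where
  "bounded_clinear T \<longleftrightarrow> bounded_linear T \<and> (\<forall>c x. T (c *\<^sub>C x) = c *\<^sub>C T x)"


section \<open>Hilbert space tensor products\<close>

text \<open>The Hilbert space tensor product is determined up to a unique unitary map compatible
  with the elementary tensors. We do not single out one construction of it:
  \<open>hilbert_tensor t\<close> says that the Hilbert space \<open>'c\<close>, with elementary tensors
  \<open>t u v\<close>, is a Hilbert space tensor product of \<open>'a\<close> and \<open>'b\<close>. The library's
  \<open>span\<close> is the real linear span; as the set of elementary tensors is closed under
  complex scaling, it agrees here with the complex linear span.\<close>

definition hilbert_tensor ::
  "('a::chilbert_space \<Rightarrow> 'b::chilbert_space \<Rightarrow> 'c::chilbert_space) \<Rightarrow> bool" where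
  "hilbert_tensor t \<longleftrightarrow>
     (\<forall>u u' v. t (u + u') v = t u v + t u' v) \<and>
     (\<forall>u v v'. t u (v + v') = t u v + t u v') \<and>
     (\<forall>c u v. t (c *\<^sub>C u) v = c *\<^sub>C t u v) \<and>
     (\<forall>c u v. t u (c *\<^sub>C v) = c *\<^sub>C t u v) \<and>
     (\<forall>u v u' v'. cinner (t u v) (t u' v') = cinner u u' * cinner v v') \<and>
     closure (span {t u v |u v. True}) = UNIV"

lemma hilbert_tensor_scaleC: "hilbert_tensor (\<lambda>(u::'a::chilbert_space) (v::complex). v *\<^sub>C u)"
proof -
  have one: "1 *\<^sub>C u = u" for u :: 'a
    using scaleR_scaleC[of 1 u] by simp
  have conj: "cinner x (c *\<^sub>C y) = cnj c * cinner x y" for c and x y :: 'a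
    by (metis cinner_commute cinner_scaleC_left complex_cnj_mult)
  have "{v *\<^sub>C u |(u::'a) v. True} = UNIV"
    using one by (metis (mono_tags, lifting) UNIV_eq_I mem_Collect_eq)
  then show ?thesis
    unfolding hilbert_tensor_def
    by (simp add: scaleC_add_right scaleC_add_left scaleC_scaleC cinner_scaleC_left conj
        scaleC_complex_def cinner_complex_def mult_ac)
qed

definition is_tensor_op ::
  "('a::chilbert_space \<Rightarrow> 'b::chilbert_space \<Rightarrow> 'c::chilbert_space) \<Rightarrow>
   ('a \<Rightarrow> 'a) \<Rightarrow> ('b \<Rightarrow> 'b) \<Rightarrow> ('c \<Rightarrow> 'c) \<Rightarrow> bool" where
  "is_tensor_op t S T R \<longleftrightarrow> bounded_clinear R \<and> (\<forall>u v. R (t u v) = t (S u) (T v))"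

definition tensor_op ::
  "('a::chilbert_space \<Rightarrow> 'b::chilbert_space \<Rightarrow> 'c::chilbert_space) \<Rightarrow>
   ('a \<Rightarrow> 'a) \<Rightarrow> ('b \<Rightarrow> 'b) \<Rightarrow> 'c \<Rightarrow> 'c" where
  "tensor_op t S T = (THE R. is_tensor_op t S T R)"

lemma tensor_op_eqI:
  assumes "hilbert_tensor t" and R: "is_tensor_op t S T R"
  shows "tensor_op t S T = R"
  unfolding tensor_op_def
proof (rule the_equality[where P = "is_tensor_op t S T", OF R])
  fix R' assume R': "is_tensor_op t S T R'"
  let ?E = "{t u v |u v. True}"
  have lin: "bounded_linear (\<lambda>x. R' x - R x)"
    using R R' unfolding is_tensor_op_def bounded_clinear_def by (blast intro: bounded_linear_sub)
  have "R' x - R x = 0" if "x \<in> span ?E" for x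
    using that
    by (rule linear_eq_0_on_span[OF bounded_linear.linear[OF lin], rotated])
      (use R R' in \<open>auto simp: is_tensor_op_def\<close>)
  moreover have "closed {x. R' x - R x = 0}"
    by (intro closed_Collect_eq continuous_intros linear_continuous_on lin)
  ultimately have "closure (span ?E) \<subseteq> {x. R' x - R x = 0}"
    by (intro closure_minimal) auto
  moreover have "closure (span ?E) = UNIV"
    using assms(1) unfolding hilbert_tensor_def by blast
  ultimately have "R' x - R x = 0" for x
    by blast
  then show "R' = R"
    by (intro ext) (simp only: right_minus_eq)
qed

definition tensor_map ::
  "('a \<Rightarrow> 'b \<Rightarrow> 'c) \<Rightarrow> ('x \<Rightarrow> 'a) \<Rightarrow> ('y \<Rightarrow> 'b) \<Rightarrow> 'x \<times> 'y \<Rightarrow> 'c" where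
  "tensor_map t F1 F2 = (\<lambda>(x1, x2). t (F1 x1) (F2 x2))"


section \<open>The space $L^2$\<close>

definition square_integrable :: "'x measure \<Rightarrow> ('x \<Rightarrow> complex) \<Rightarrow> bool" where
  "square_integrable M \<phi> \<longleftrightarrow>
     \<phi> \<in> borel_measurable M \<and> integrable M (\<lambda>x. (cmod (\<phi> x))\<^sup>2)"

text \<open>The elements of \<open>L2 M\<close> are the classes of square integrable functions modulo equality
  almost everywhere. The operations on classes are defined through a chosen representative.\<close>

definition L2_class :: "'x measure \<Rightarrow> ('x \<Rightarrow> complex) \<Rightarrow> ('x \<Rightarrow> complex) set" where
  "L2_class M \<phi> = {\<psi>. square_integrable M \<psi> \<and> (AE x in M. \<psi> x = \<phi> x)}"

definition L2 :: "'x measure \<Rightarrow> ('x \<Rightarrow> complex) set set" where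
  "L2 M = L2_class M ` {\<phi>. square_integrable M \<phi>}"

definition L2_rep :: "('x \<Rightarrow> complex) set \<Rightarrow> 'x \<Rightarrow> complex" where
  "L2_rep a = (SOME \<phi>. \<phi> \<in> a)"

definition L2_add ::
  "'x measure \<Rightarrow> ('x \<Rightarrow> complex) set \<Rightarrow> ('x \<Rightarrow> complex) set \<Rightarrow> ('x \<Rightarrow> complex) set" where
  "L2_add M a b = L2_class M (\<lambda>x. L2_rep a x + L2_rep b x)"

definition L2_scale ::
  "'x measure \<Rightarrow> complex \<Rightarrow> ('x \<Rightarrow> complex) set \<Rightarrow> ('x \<Rightarrow> complex) set" where
  "L2_scale M c a = L2_class M (\<lambda>x. c * L2_rep a x)"

definition L2_inner ::
  "'x measure \<Rightarrow> ('x \<Rightarrow> complex) set \<Rightarrow> ('x \<Rightarrow> complex) set \<Rightarrow> complex" where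
  "L2_inner M a b = (\<integral>x. L2_rep a x * cnj (L2_rep b x) \<partial>M)"

definition L2_norm :: "'x measure \<Rightarrow> ('x \<Rightarrow> complex) set \<Rightarrow> real" where
  "L2_norm M a = sqrt (\<integral>x. (cmod (L2_rep a x))\<^sup>2 \<partial>M)"

definition L2_bounded_clinear ::
  "'x measure \<Rightarrow> (('x \<Rightarrow> complex) set \<Rightarrow> 'h::chilbert_space) \<Rightarrow> bool" where
  "L2_bounded_clinear M T \<longleftrightarrow>
     (\<forall>a\<in>L2 M. \<forall>b\<in>L2 M. T (L2_add M a b) = T a + T b) \<and>
     (\<forall>c. \<forall>a\<in>L2 M. T (L2_scale M c a) = c *\<^sub>C T a) \<and>
     (\<exists>K. \<forall>a\<in>L2 M. norm (T a) \<le> K * L2_norm M a)"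

definition is_L2_adjoint ::
  "'x measure \<Rightarrow> (('x \<Rightarrow> complex) set \<Rightarrow> 'h::chilbert_space) \<Rightarrow>
   ('h \<Rightarrow> ('x \<Rightarrow> complex) set) \<Rightarrow> bool" where
  "is_L2_adjoint M T A \<longleftrightarrow>
     (\<forall>f. A f \<in> L2 M) \<and> (\<forall>a\<in>L2 M. \<forall>f. cinner (T a) f = L2_inner M a (A f))"

definition L2_adjoint ::
  "'x measure \<Rightarrow> (('x \<Rightarrow> complex) set \<Rightarrow> 'h::chilbert_space) \<Rightarrow> 'h \<Rightarrow> ('x \<Rightarrow> complex) set" where
  "L2_adjoint M T = (THE A. is_L2_adjoint M T A)"


section \<open>Continuous frames\<close>

definition weakly_measurable :: "'x measure \<Rightarrow> ('x \<Rightarrow> 'h::chilbert_space) \<Rightarrow> bool" where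
  "weakly_measurable M F \<longleftrightarrow> (\<forall>f. (\<lambda>x. cinner f (F x)) \<in> borel_measurable M)"

definition bessel_mapping :: "'x measure \<Rightarrow> ('x \<Rightarrow> 'h::chilbert_space) \<Rightarrow> bool" where
  "bessel_mapping M F \<longleftrightarrow> weakly_measurable M F \<and>
     (\<exists>B\<ge>0. \<forall>f. (\<integral>\<^sup>+x. ennreal ((cmod (cinner f (F x)))\<^sup>2) \<partial>M) \<le> ennreal (B * (norm f)\<^sup>2))"

definition continuous_frame :: "'x measure \<Rightarrow> ('x \<Rightarrow> 'h::chilbert_space) \<Rightarrow> bool" where
  "continuous_frame M F \<longleftrightarrow> weakly_measurable M F \<and>
     (\<exists>A>0. \<exists>B\<ge>0. \<forall>f.
        ennreal (A * (norm f)\<^sup>2) \<le> (\<integral>\<^sup>+x. ennreal ((cmod (cinner f (F x)))\<^sup>2) \<partial>M) \<and>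
        (\<integral>\<^sup>+x. ennreal ((cmod (cinner f (F x)))\<^sup>2) \<partial>M) \<le> ennreal (B * (norm f)\<^sup>2))"

definition has_weak_integral ::
  "'x measure \<Rightarrow> ('x \<Rightarrow> 'h::chilbert_space) \<Rightarrow> 'h \<Rightarrow> bool" where
  "has_weak_integral M G h \<longleftrightarrow>
     (\<forall>g. integrable M (\<lambda>x. cinner (G x) g) \<and> (\<integral>x. cinner (G x) g \<partial>M) = cinner h g)"

definition weak_integral :: "'x measure \<Rightarrow> ('x \<Rightarrow> 'h::chilbert_space) \<Rightarrow> 'h" where
  "weak_integral M G = (THE h. has_weak_integral M G h)"

definition synthesis_op ::
  "'x measure \<Rightarrow> ('x \<Rightarrow> 'h::chilbert_space) \<Rightarrow> ('x \<Rightarrow> complex) set \<Rightarrow> 'h" where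
  "synthesis_op M F a = weak_integral M (\<lambda>x. L2_rep a x *\<^sub>C F x)"

definition analysis_op ::
  "'x measure \<Rightarrow> ('x \<Rightarrow> 'h::chilbert_space) \<Rightarrow> 'h \<Rightarrow> ('x \<Rightarrow> complex) set" where
  "analysis_op M F = L2_adjoint M (synthesis_op M F)"

definition frame_op :: "'x measure \<Rightarrow> ('x \<Rightarrow> 'h::chilbert_space) \<Rightarrow> 'h \<Rightarrow> 'h" where
  "frame_op M F = synthesis_op M F \<circ> analysis_op M F"

definition canonical_dual :: "'x measure \<Rightarrow> ('x \<Rightarrow> 'h::chilbert_space) \<Rightarrow> 'x \<Rightarrow> 'h" where
  "canonical_dual M F = (\<lambda>x. inv (frame_op M F) (F x))"

end

theory Submission
  imports Defs
begin

text \<open>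
  The synthesis operator exists because, for a Bessel mapping \<open>F\<close> and a square integrable \<open>\<phi>\<close>,
  the map \<open>g \<mapsto> \<integral> \<phi> x \<langle>F x, g\<rangle>\<close> is a bounded conjugate linear functional: this is the
  Cauchy-Schwarz inequality in \<open>L2\<close>, applied to \<open>\<phi>\<close> and \<open>x \<mapsto> \<langle>g, F x\<rangle>\<close>.  The Riesz theorem turns
  it into a vector (\<open>bessel_weak_integral_exists\<close>).  The same pairing, read as an inner product in
  \<open>L2\<close>, exhibits \<open>f \<mapsto> \<langle>f, F \<cdot>\<rangle>\<close> as the adjoint (\<open>synthesis_op_adjoint\<close>).  The frame operator
  \<open>S\<close> is therefore determined by \<open>\<langle>S f, g\<rangle> = \<integral> \<langle>f, F x\<rangle> \<langle>F x, g\<rangle>\<close>.  It is self-adjoint,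
  and the lower frame bound makes it coercive, hence bijective (\<open>frame_op_bij\<close>).  Both the Riesz
  theorem and this bijectivity come from one variational argument (\<open>symmetric_lax_milgram\<close>).

  For two frames, the crux is that \<open>F1 \<otimes> F2\<close> satisfies both frame inequalities on vectors that are
  not elementary tensors.  A finite sum of elementary tensors can be written as \<open>\<Sum> w e \<otimes> e\<close>, with
  \<open>e\<close> ranging over an orthonormal set (\<open>span_tensor_orthonormal\<close>).  By Tonelli's theorem the frame
  integral of such a vector is an iterated integral, in which the frame inequality of \<open>F2\<close> is used
  first, for fixed \<open>x\<close>, and then that of \<open>F1\<close> for each \<open>w e\<close>; by the Pythagorean theorem the bounds
  multiply (\<open>continuous_frame_tensor_map\<close>).  Finite sums are dense, and frame inequalities on a
  dense set imply frame inequalities everywhere (\<open>continuous_frame_if_dense\<close>).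

  Once \<open>F1 \<otimes> F2\<close> is known to be a frame, Fubini's theorem evaluates its frame operator on
  elementary tensors (\<open>frame_op_tensor\<close>), which determine a bounded operator.  The formula for the
  canonical dual follows by solving \<open>S h = F1 x \<otimes> F2 y\<close> with an elementary tensor \<open>h\<close>.
\<close>

section \<open>Geometry of complex inner product spaces\<close>

lemma cinner_add_right: "cinner (x::'a::complex_inner) (y + z) = cinner x y + cinner x z"
  by (metis cinner_add_left cinner_commute complex_cnj_add)

lemma cinner_scaleC_right: "cinner (x::'a::complex_inner) (c *\<^sub>C y) = cnj c * cinner x y"
  by (metis cinner_commute cinner_scaleC_left complex_cnj_mult)

lemma norm_scaleC: "norm (c *\<^sub>C (x::'a::complex_inner)) = cmod c * norm x"
proof -
  have "complex_of_real ((norm (c *\<^sub>C x))\<^sup>2) = (c * cnj c) * complex_of_real ((norm x)\<^sup>2)"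
    unfolding cinner_self[symmetric] by (simp add: cinner_scaleC_left cinner_scaleC_right)
  also have "\<dots> = complex_of_real ((cmod c * norm x)\<^sup>2)"
    by (simp only: complex_norm_square[symmetric] of_real_mult[symmetric] power_mult_distrib)
  finally have "(norm (c *\<^sub>C x))\<^sup>2 = (cmod c * norm x)\<^sup>2"
    by (simp only: of_real_eq_iff)
  then show ?thesis
    by (rule power2_eq_imp_eq) simp_all
qed

text \<open>For \<open>y \<noteq> 0\<close> the inequality states that the component of \<open>x\<close> orthogonal to \<open>y\<close> has
  nonnegative square norm.\<close>

lemma cinner_cauchy_schwarz: "cmod (cinner x y) \<le> norm (x::'a::complex_inner) * norm y"
proof (cases "y = 0")
  case True
  have "cinner x (0 *\<^sub>C y) = 0"
    by (simp add: cinner_scaleC_right)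
  moreover have "0 *\<^sub>C y = 0"
    using scaleR_scaleC[of 0 y] by simp
  ultimately show ?thesis
    using True by simp
next
  case False
  define n where "n = (norm y)\<^sup>2"
  have n: "n > 0"
    using False by (simp add: n_def)
  define c where "c = cinner x y / complex_of_real n"
  have yy: "cinner y y = complex_of_real n"
    by (simp add: cinner_self n_def)
  have yx: "cinner y x = cnj (cinner x y)"
    by (rule cinner_commute)
  have "complex_of_real ((norm (x + (- c) *\<^sub>C y))\<^sup>2) = cinner (x + (- c) *\<^sub>C y) (x + (- c) *\<^sub>C y)"
    by (simp add: cinner_self)
  also have "\<dots> = complex_of_real ((norm x)\<^sup>2) - cinner x y * cnj (cinner x y) / complex_of_real n"
    using n by (simp add: cinner_add_left cinner_add_right cinner_scaleC_left cinner_scaleC_right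
        yy yx cinner_self[of x] c_def)
  also have "\<dots> = complex_of_real ((norm x)\<^sup>2 - (cmod (cinner x y))\<^sup>2 / n)"
    by (simp add: complex_norm_square[symmetric])
  finally have "(norm (x + (- c) *\<^sub>C y))\<^sup>2 = (norm x)\<^sup>2 - (cmod (cinner x y))\<^sup>2 / n"
    by (simp only: of_real_eq_iff)
  then have "(cmod (cinner x y))\<^sup>2 / n \<le> (norm x)\<^sup>2"
    by (metis diff_ge_0_iff_ge zero_le_power2)
  then have "(cmod (cinner x y))\<^sup>2 \<le> (norm x * norm y)\<^sup>2"
    using n by (simp add: field_simps n_def power_mult_distrib)
  then show ?thesis
    by (rule power2_le_imp_le) simp
qed

lemma bounded_bilinear_cinner: "bounded_bilinear (cinner :: 'a::complex_inner \<Rightarrow> 'a \<Rightarrow> complex)"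
proof
  show "\<exists>K. \<forall>a b::'a. cmod (cinner a b) \<le> norm a * norm b * K"
    by (rule exI[of _ 1]) (simp add: cinner_cauchy_schwarz)
qed (simp_all add: cinner_add_left cinner_add_right cinner_scaleC_left cinner_scaleC_right
    scaleR_scaleC[where 'a = 'a] scaleR_conv_of_real)

interpretation cinner: bounded_bilinear "cinner :: 'a::complex_inner \<Rightarrow> 'a \<Rightarrow> complex"
  by (rule bounded_bilinear_cinner)

lemma cinner_eqI:
  fixes x y :: "'a::complex_inner"
  assumes "\<And>z. cinner x z = cinner y z"
  shows "x = y"
proof -
  have "cinner (x - y) (x - y) = 0"
    using assms[of "x - y"] by (simp add: cinner.diff_left)
  then show ?thesis
    by (simp add: cinner_self)
qed

text \<open>The imaginary part of an inner product is the real part of one with a vector rotated by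
  \<open>\<i>\<close>.  Hence a conjugate linear functional is determined by its real part, which reduces
  complex representation problems to real ones.\<close>

lemma cinner_eq_of_Re_eq:
  fixes h :: "'a::complex_inner"
  assumes scale: "\<And>c g. L (c *\<^sub>C g) = cnj c * L g"
    and Re: "\<And>g. Re (cinner h g) = Re (L g)"
  shows "cinner h g = L g"
proof (rule complex_eqI)
  show "Re (cinner h g) = Re (L g)"
    by (rule Re)
  show "Im (cinner h g) = Im (L g)"
    using Re[of "\<i> *\<^sub>C g"] by (simp add: scale cinner_scaleC_right)
qed

lemma pythagoras_sum:
  fixes g :: "'i \<Rightarrow> 'a::complex_inner"
  assumes "finite E" and "\<And>i j. i \<in> E \<Longrightarrow> j \<in> E \<Longrightarrow> i \<noteq> j \<Longrightarrow> cinner (g i) (g j) = 0"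
  shows "(norm (\<Sum>i\<in>E. g i))\<^sup>2 = (\<Sum>i\<in>E. (norm (g i))\<^sup>2)"
proof -
  have "complex_of_real ((norm (\<Sum>i\<in>E. g i))\<^sup>2) = (\<Sum>i\<in>E. \<Sum>j\<in>E. cinner (g i) (g j))"
    unfolding cinner_self[symmetric] cinner.sum_left by (simp only: cinner.sum_right)
  also have "\<dots> = (\<Sum>i\<in>E. \<Sum>j\<in>E. if j = i then cinner (g i) (g i) else 0)"
    using assms(2) by (intro sum.cong refl) (metis (full_types))
  also have "\<dots> = complex_of_real (\<Sum>i\<in>E. (norm (g i))\<^sup>2)"
    using assms(1) by (simp add: cinner_self)
  finally show ?thesis
    by (simp only: of_real_eq_iff)
qed

section \<open>Energy minimisation\<close>

text \<open>The symmetric Lax-Milgram theorem.  The energy \<open>b x x - 2 * l x\<close> is bounded below by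
  coercivity; the parallelogram identity makes every minimising sequence Cauchy; and the
  vanishing of the first variation at the minimiser is the desired equation.  It serves twice
  below: with the inner product as \<open>b\<close> it gives the Riesz representation theorem, and with
  \<open>b x y = Re (cinner (S x) y)\<close> it gives surjectivity of a coercive operator \<open>S\<close>.\<close>

lemma symmetric_lax_milgram:
  fixes b :: "'a::banach \<Rightarrow> 'a \<Rightarrow> real"
  assumes b: "bounded_bilinear b" and sym: "\<And>x y. b x y = b y x"
    and A: "A > 0" and coercive: "\<And>x. A * (norm x)\<^sup>2 \<le> b x x"
    and l: "bounded_linear l"
  shows "\<exists>h. \<forall>g. b h g = l g"
proof -
  interpret b: bounded_bilinear b by (rule b)
  interpret l: bounded_linear l by (rule l)
  define J where "J x = b x x - 2 * l x" for x
  obtain K where K: "\<And>x. norm (l x) \<le> norm x * K"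
    using l.bounded by blast
  have lower: "- K\<^sup>2 / A \<le> J x" for x
  proof -
    have "0 \<le> A * (norm x - K / A)\<^sup>2"
      using A by simp
    also have "\<dots> = A * (norm x)\<^sup>2 - 2 * (norm x * K) + K\<^sup>2 / A"
      using A by (simp add: power2_eq_square field_simps)
    also have "\<dots> \<le> J x + K\<^sup>2 / A"
      using coercive[of x] K[of x] by (simp add: J_def)
    finally show ?thesis by simp
  qed
  then have bdd: "bdd_below (range J)"
    by (intro bdd_belowI2)
  define m where "m = Inf (range J)"
  have m: "m \<le> J x" for x
    unfolding m_def by (rule cInf_lower[OF _ bdd]) simp
  have "\<exists>x. J x < m + inverse (real (Suc n))" for n
    using cInf_lessD[of "range J" "m + inverse (real (Suc n))"] by (auto simp: m_def)
  then obtain f where f: "\<And>n. J (f n) < m + inverse (real (Suc n))"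
    by metis
  have parallelogram: "A / 2 * (norm (x - y))\<^sup>2 \<le> J x + J y - 2 * m" for x y
  proof -
    have "A * (norm (x - y))\<^sup>2 \<le> b (x - y) (x - y)"
      by (rule coercive)
    moreover have "J x + J y - 2 * J ((1/2) *\<^sub>R (x + y)) = b (x - y) (x - y) / 2"
      by (simp add: J_def b.add_left b.add_right b.diff_left b.diff_right b.scaleR_left
          b.scaleR_right l.add l.scaleR sym[of y x] field_simps)
    ultimately show ?thesis
      using m[of "(1/2) *\<^sub>R (x + y)"] by simp
  qed
  have "Cauchy f"
  proof (rule CauchyI)
    fix e :: real assume e: "e > 0"
    then obtain N where N: "inverse (real (Suc N)) < A * e\<^sup>2 / 4"
      using reals_Archimedean[of "A * e\<^sup>2 / 4"] A by auto
    have "norm (f j - f k) < e" if "j \<ge> N" "k \<ge> N" for j k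
    proof -
      have "inverse (real (Suc j)) \<le> inverse (real (Suc N))"
        "inverse (real (Suc k)) \<le> inverse (real (Suc N))"
        using that by (simp_all add: field_simps)
      then have "A / 2 * (norm (f j - f k))\<^sup>2 < A / 2 * e\<^sup>2"
        using parallelogram[of "f j" "f k"] f[of j] f[of k] N by linarith
      then have "(norm (f j - f k))\<^sup>2 < e\<^sup>2"
        using A by simp
      then show ?thesis
        by (rule power2_less_imp_less) (use e in simp)
    qed
    then show "\<exists>M. \<forall>m\<ge>M. \<forall>n\<ge>M. norm (f m - f n) < e"
      by blast
  qed
  then obtain h where h: "f \<longlonglongrightarrow> h"
    using Cauchy_convergent_iff convergent_def by blast
  have "(\<lambda>n. J (f n)) \<longlonglongrightarrow> J h"
    unfolding J_def by (intro tendsto_intros b.tendsto l.tendsto h)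
  moreover have "(\<lambda>n. m + inverse (real (Suc n))) \<longlonglongrightarrow> m"
    using LIMSEQ_inverse_real_of_nat_add by simp
  ultimately have "J h \<le> m"
    by (rule LIMSEQ_le) (use f less_imp_le in blast)
  then have min: "J h \<le> J x" for x
    using m[of x] by simp
  have "b h g = l g" for g
  proof -
    define d where "d = b h g - l g"
    define q where "q = b g g"
    have q: "q \<ge> 0"
      using coercive[of g] A unfolding q_def
      by (meson less_imp_le mult_nonneg_nonneg order_trans zero_le_power2)
    \<comment> \<open>a step along \<open>g\<close> that lowers the energy unless \<open>d = 0\<close>; the summand \<open>1\<close> allows \<open>q = 0\<close>\<close>
    define s where "s = - d / (q + 1)"
    have "J (h + s *\<^sub>R g) = J h + 2 * s * d + s\<^sup>2 * q"
      by (simp add: J_def d_def q_def b.add_left b.add_right b.scaleR_left b.scaleR_right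
          l.add l.scaleR sym[of g h] power2_eq_square algebra_simps)
    then have "0 \<le> 2 * s * d + s\<^sup>2 * q"
      using min[of "h + s *\<^sub>R g"] by simp
    also have "2 * s * d + s\<^sup>2 * q = - (d\<^sup>2 * (q + 2)) / (q + 1)\<^sup>2"
      using q by (simp add: s_def divide_simps power2_eq_square) (simp add: algebra_simps)
    finally have "d\<^sup>2 * (q + 2) \<le> 0"
      using q by (simp add: divide_simps zero_le_mult_iff)
    then have "d = 0"
      using q by (simp add: mult_le_0_iff)
    then show ?thesis
      by (simp add: d_def)
  qed
  then show ?thesis by blast
qed

lemma bounded_bilinear_Re_cinner:
  fixes S :: "'a::complex_inner \<Rightarrow> 'a"
  assumes "bounded_linear S"
  shows "bounded_bilinear (\<lambda>x y. Re (cinner (S x) y))"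
proof -
  interpret S: bounded_linear S by (rule assms)
  obtain K where K: "K \<ge> 0" "\<And>x. norm (S x) \<le> norm x * K"
    using S.nonneg_bounded by blast
  have "norm (Re (cinner (S x) y)) \<le> norm x * norm y * K" for x y
  proof -
    have "norm (Re (cinner (S x) y)) \<le> cmod (cinner (S x) y)"
      by (simp add: abs_Re_le_cmod)
    also have "\<dots> \<le> norm (S x) * norm y"
      by (rule cinner_cauchy_schwarz)
    also have "\<dots> \<le> (norm x * K) * norm y"
      by (intro mult_right_mono K(2)) simp
    finally show ?thesis
      by (simp add: mult_ac)
  qed
  then show ?thesis
    by unfold_locales
      (auto simp: S.add S.scaleR cinner_add_left cinner_add_right cinner.scaleR_left
        cinner.scaleR_right)
qed

text \<open>The Riesz representation theorem; the functional is conjugate linear because the inner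
  product is conjugate linear in its second argument.\<close>

lemma riesz_representation:
  fixes L :: "'a::chilbert_space \<Rightarrow> complex"
  assumes add: "\<And>x y. L (x + y) = L x + L y" and scale: "\<And>c x. L (c *\<^sub>C x) = cnj c * L x"
    and bound: "\<And>x. cmod (L x) \<le> K * norm x"
  shows "\<exists>h. \<forall>g. cinner h g = L g"
proof -
  have "bounded_linear (\<lambda>g. Re (L g))"
  proof (rule bounded_linear_intro)
    show "norm (Re (L x)) \<le> norm x * K" for x
      using abs_Re_le_cmod[of "L x"] bound[of x] by (simp add: mult.commute)
  qed (simp_all add: add scale scaleR_scaleC[where 'a = 'a])
  moreover have "bounded_bilinear (\<lambda>x y::'a. Re (cinner x y))"
    using bounded_bilinear_Re_cinner[OF bounded_linear_ident] by simp
  moreover have "Re (cinner x y) = Re (cinner y x)" for x y :: 'a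
    by (subst cinner_commute) simp
  ultimately obtain h where "\<And>g. Re (cinner h g) = Re (L g)"
    using symmetric_lax_milgram[of "\<lambda>x y. Re (cinner x y)" 1 "\<lambda>g. Re (L g)"]
    by (auto simp: cinner_self)
  then show ?thesis
    using cinner_eq_of_Re_eq[of L h, OF scale] by blast
qed

text \<open>Coercivity gives injectivity at once; a preimage of \<open>h\<close> is the minimiser of the energy
  \<open>Re (cinner (S f) f) - 2 * Re (cinner h f)\<close>.\<close>

lemma coercive_selfadjoint_bij:
  fixes S :: "'a::chilbert_space \<Rightarrow> 'a"
  assumes S: "bounded_linear S" and sym: "\<And>f g. cinner (S f) g = cinner f (S g)"
    and A: "A > 0" and coercive: "\<And>f. A * (norm f)\<^sup>2 \<le> Re (cinner (S f) f)"
  shows "bij S"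
proof (rule bijI)
  interpret S: bounded_linear S by (rule S)
  show "inj S"
  proof (rule injI)
    fix x y assume "S x = S y"
    then have "A * (norm (x - y))\<^sup>2 \<le> 0"
      using coercive[of "x - y"] by (simp add: S.diff cinner.zero_left)
    then show "x = y"
      using A by (simp add: mult_le_0_iff)
  qed
  have "\<exists>f. S f = h" for h
  proof -
    have "Re (cinner (S x) y) = Re (cinner (S y) x)" for x y
      by (subst sym, subst cinner_commute) simp
    moreover have "bounded_linear (\<lambda>g. Re (cinner h g))"
      by (rule bounded_linear_compose[OF bounded_linear_Re cinner.bounded_linear_right])
    ultimately obtain f where "\<And>g. Re (cinner (S f) g) = Re (cinner h g)"
      using symmetric_lax_milgram[OF bounded_bilinear_Re_cinner[OF S], of A "\<lambda>g. Re (cinner h g)"]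
        A coercive by auto
    then have "cinner (S f) g = cinner h g" for g
      by (intro cinner_eq_of_Re_eq[of "cinner h"] cinner_scaleC_right)
    then show ?thesis
      using cinner_eqI by blast
  qed
  then show "surj S"
    by (metis surjI)
qed

section \<open>Square integrable functions and their classes\<close>

lemma borel_measurable_cnj [measurable (raw)]:
  assumes "\<phi> \<in> borel_measurable M"
  shows "(\<lambda>x. cnj (\<phi> x)) \<in> borel_measurable M"
  by (rule borel_measurable_continuous_on[OF _ assms]) (intro continuous_intros)

lemma square_integrable_measurable:
  "square_integrable M \<phi> \<Longrightarrow> \<phi> \<in> borel_measurable M"
  by (simp add: square_integrable_def)

text \<open>Pointwise, \<open>2 * cmod (\<phi> x) * cmod (\<psi> x) \<le> (cmod (\<phi> x))\<^sup>2 + (cmod (\<psi> x))\<^sup>2\<close>.\<close>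

lemma integrable_cmod_mult_cmod:
  assumes "square_integrable M \<phi>" "square_integrable M \<psi>"
  shows "integrable M (\<lambda>x. cmod (\<phi> x) * cmod (\<psi> x))"
proof (rule Bochner_Integration.integrable_bound)
  show "integrable M (\<lambda>x. (cmod (\<phi> x))\<^sup>2 + (cmod (\<psi> x))\<^sup>2)"
    using assms by (simp add: square_integrable_def)
  show "(\<lambda>x. cmod (\<phi> x) * cmod (\<psi> x)) \<in> borel_measurable M"
    using assms[THEN square_integrable_measurable] by measurable
  have "a * b \<le> a\<^sup>2 + b\<^sup>2" if "a \<ge> 0" "b \<ge> 0" for a b :: real
    using that zero_le_power2[of "a - b"] mult_nonneg_nonneg[OF that]
    unfolding power2_diff by linarith
  then show "AE x in M. norm (cmod (\<phi> x) * cmod (\<psi> x)) \<le> norm ((cmod (\<phi> x))\<^sup>2 + (cmod (\<psi> x))\<^sup>2)"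
    by simp
qed

lemma square_integrable_mult_cnj:
  assumes "square_integrable M \<phi>" "square_integrable M \<psi>"
  shows "integrable M (\<lambda>x. \<phi> x * cnj (\<psi> x))"
proof (rule Bochner_Integration.integrable_bound[OF integrable_cmod_mult_cmod[OF assms]])
  show "(\<lambda>x. \<phi> x * cnj (\<psi> x)) \<in> borel_measurable M"
    using assms[THEN square_integrable_measurable] by measurable
qed (simp add: norm_mult)

lemma L2_pairing_cauchy_schwarz:
  assumes "square_integrable M \<phi>" "square_integrable M \<psi>"
  shows "cmod (\<integral>x. \<phi> x * cnj (\<psi> x) \<partial>M)
    \<le> sqrt (\<integral>x. (cmod (\<phi> x))\<^sup>2 \<partial>M) * sqrt (\<integral>x. (cmod (\<psi> x))\<^sup>2 \<partial>M)"
proof -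
  note [measurable] = assms[THEN square_integrable_measurable]
  let ?I = "\<integral>x. cmod (\<phi> x) * cmod (\<psi> x) \<partial>M"
  have "(ennreal ?I)\<^sup>2 = (\<integral>\<^sup>+x. ennreal (cmod (\<phi> x)) * ennreal (cmod (\<psi> x)) \<partial>M)\<^sup>2"
    using integrable_cmod_mult_cmod[OF assms]
    by (simp add: nn_integral_eq_integral[symmetric] ennreal_mult'')
  also have "\<dots> \<le> (\<integral>\<^sup>+x. (ennreal (cmod (\<phi> x)))\<^sup>2 \<partial>M) * (\<integral>\<^sup>+x. (ennreal (cmod (\<psi> x)))\<^sup>2 \<partial>M)"
    by (rule Cauchy_Schwarz_nn_integral) measurable
  also have "\<dots> = ennreal ((\<integral>x. (cmod (\<phi> x))\<^sup>2 \<partial>M) * (\<integral>x. (cmod (\<psi> x))\<^sup>2 \<partial>M))"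
    using assms
    by (simp add: square_integrable_def nn_integral_eq_integral ennreal_power ennreal_mult'')
  finally have "?I\<^sup>2 \<le> (\<integral>x. (cmod (\<phi> x))\<^sup>2 \<partial>M) * (\<integral>x. (cmod (\<psi> x))\<^sup>2 \<partial>M)"
    by (simp add: ennreal_power)
  then have "?I \<le> sqrt (\<integral>x. (cmod (\<phi> x))\<^sup>2 \<partial>M) * sqrt (\<integral>x. (cmod (\<psi> x))\<^sup>2 \<partial>M)"
    unfolding real_sqrt_mult[symmetric] by (rule real_le_rsqrt)
  moreover have "cmod (\<integral>x. \<phi> x * cnj (\<psi> x) \<partial>M) \<le> ?I"
    using integral_norm_bound[of M "\<lambda>x. \<phi> x * cnj (\<psi> x)"] by (simp add: norm_mult)
  ultimately show ?thesis
    by simp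
qed

lemma square_integrable_scale:
  "square_integrable M \<phi> \<Longrightarrow> square_integrable M (\<lambda>x. c * \<phi> x)"
  by (auto simp: square_integrable_def norm_mult power_mult_distrib)

lemma square_integrable_add:
  assumes "square_integrable M \<phi>" "square_integrable M \<psi>"
  shows "square_integrable M (\<lambda>x. \<phi> x + \<psi> x)"
  unfolding square_integrable_def
proof
  note [measurable] = assms[THEN square_integrable_measurable]
  show "(\<lambda>x. \<phi> x + \<psi> x) \<in> borel_measurable M"
    by measurable
  show "integrable M (\<lambda>x. (cmod (\<phi> x + \<psi> x))\<^sup>2)"
  proof (rule Bochner_Integration.integrable_bound)
    show "integrable M (\<lambda>x. 2 * (cmod (\<phi> x))\<^sup>2 + 2 * (cmod (\<psi> x))\<^sup>2)"
      using assms by (simp add: square_integrable_def)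
    have "(cmod (a + b))\<^sup>2 \<le> 2 * (cmod a)\<^sup>2 + 2 * (cmod b)\<^sup>2" for a b
      using norm_triangle_ineq[of a b] power_mono[of "cmod (a + b)" "cmod a + cmod b" 2]
        zero_le_power2[of "cmod a - cmod b"]
      by (simp add: power2_sum power2_diff)
    then show "AE x in M. norm ((cmod (\<phi> x + \<psi> x))\<^sup>2)
        \<le> norm (2 * (cmod (\<phi> x))\<^sup>2 + 2 * (cmod (\<psi> x))\<^sup>2)"
      by simp
  qed measurable
qed

lemma L2_class_cong:
  assumes "AE x in M. \<phi> x = \<psi> x"
  shows "L2_class M \<phi> = L2_class M \<psi>"
  using assms unfolding L2_class_def by (auto elim!: AE_mp)

lemma L2_rep_L2_class:
  assumes "square_integrable M \<phi>"
  shows "square_integrable M (L2_rep (L2_class M \<phi>))"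
    and "AE x in M. L2_rep (L2_class M \<phi>) x = \<phi> x"
proof -
  have "\<phi> \<in> L2_class M \<phi>"
    using assms by (simp add: L2_class_def)
  then have "L2_rep (L2_class M \<phi>) \<in> L2_class M \<phi>"
    unfolding L2_rep_def by (rule someI[of "\<lambda>\<phi>. \<phi> \<in> _"])
  then show "square_integrable M (L2_rep (L2_class M \<phi>))"
    and "AE x in M. L2_rep (L2_class M \<phi>) x = \<phi> x"
    by (simp_all add: L2_class_def)
qed

lemma L2_class_in_L2: "square_integrable M \<phi> \<Longrightarrow> L2_class M \<phi> \<in> L2 M"
  by (simp add: L2_def)

lemma L2_rep_square_integrable: "a \<in> L2 M \<Longrightarrow> square_integrable M (L2_rep a)"
  by (auto simp: L2_def L2_rep_L2_class)

lemma L2_class_L2_rep: "a \<in> L2 M \<Longrightarrow> L2_class M (L2_rep a) = a"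
  by (auto simp: L2_def intro!: L2_class_cong L2_rep_L2_class)

lemma L2_eqI:
  assumes "a \<in> L2 M" "b \<in> L2 M" "AE x in M. L2_rep a x = L2_rep b x"
  shows "a = b"
  using L2_class_cong[OF assms(3)] assms by (simp add: L2_class_L2_rep)

lemma L2_inner_class:
  assumes "square_integrable M \<phi>" "square_integrable M \<psi>"
  shows "L2_inner M (L2_class M \<phi>) (L2_class M \<psi>) = (\<integral>x. \<phi> x * cnj (\<psi> x) \<partial>M)"
  unfolding L2_inner_def
proof (rule integral_cong_AE)
  show "AE x in M. L2_rep (L2_class M \<phi>) x * cnj (L2_rep (L2_class M \<psi>) x) = \<phi> x * cnj (\<psi> x)"
    using L2_rep_L2_class(2)[OF assms(1)] L2_rep_L2_class(2)[OF assms(2)] by eventually_elim simp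
next
  note [measurable] = assms[THEN square_integrable_measurable]
    assms[THEN L2_rep_L2_class(1), THEN square_integrable_measurable]
  show "(\<lambda>x. L2_rep (L2_class M \<phi>) x * cnj (L2_rep (L2_class M \<psi>) x)) \<in> borel_measurable M"
    "(\<lambda>x. \<phi> x * cnj (\<psi> x)) \<in> borel_measurable M"
    by measurable
qed

text \<open>Pairing with the class of \<open>L2_rep a - L2_rep b\<close> yields the square of its norm.\<close>

lemma L2_inner_ext:
  assumes a: "a \<in> L2 M" and b: "b \<in> L2 M"
    and eq: "\<And>c. c \<in> L2 M \<Longrightarrow> L2_inner M c a = L2_inner M c b"
  shows "a = b"
proof (rule L2_eqI[OF a b])
  note sa = L2_rep_square_integrable[OF a] and sb = L2_rep_square_integrable[OF b]
  define d where "d x = L2_rep a x + (- 1) * L2_rep b x" for x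
  have d: "square_integrable M d"
    unfolding d_def by (intro square_integrable_add square_integrable_scale sa sb)
  have "(\<integral>x. d x * cnj (L2_rep a x) \<partial>M) = (\<integral>x. d x * cnj (L2_rep b x) \<partial>M)"
    using eq[OF L2_class_in_L2[OF d]] L2_inner_class[OF d sa] L2_inner_class[OF d sb]
    by (simp add: L2_class_L2_rep a b)
  then have "0 = (\<integral>x. d x * cnj (L2_rep a x) - d x * cnj (L2_rep b x) \<partial>M)"
    using square_integrable_mult_cnj[OF d sa] square_integrable_mult_cnj[OF d sb] by simp
  also have "\<dots> = (\<integral>x. complex_of_real ((cmod (d x))\<^sup>2) \<partial>M)"
    by (rule Bochner_Integration.integral_cong)
      (simp_all only: complex_norm_square d_def, simp add: algebra_simps)
  also have "\<dots> = complex_of_real (\<integral>x. (cmod (d x))\<^sup>2 \<partial>M)"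
    by (rule integral_complex_of_real)
  finally have "(\<integral>x. (cmod (d x))\<^sup>2 \<partial>M) = 0"
    by (metis of_real_eq_0_iff)
  then have "AE x in M. (cmod (d x))\<^sup>2 = 0"
    using d integral_nonneg_eq_0_iff_AE[of M "\<lambda>x. (cmod (d x))\<^sup>2"]
    by (simp add: square_integrable_def)
  then show "AE x in M. L2_rep a x = L2_rep b x"
    by eventually_elim (simp add: d_def)
qed

section \<open>Synthesis and analysis operators of Bessel mappings\<close>

lemma bessel_square_integrable:
  assumes "bessel_mapping M F"
  shows "square_integrable M (\<lambda>x. cinner f (F x))"
  unfolding square_integrable_def
proof
  show [measurable]: "(\<lambda>x. cinner f (F x)) \<in> borel_measurable M"
    using assms by (simp add: bessel_mapping_def weakly_measurable_def)
  obtain B where "(\<integral>\<^sup>+x. ennreal ((cmod (cinner f (F x)))\<^sup>2) \<partial>M) \<le> ennreal (B * (norm f)\<^sup>2)"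
    using assms unfolding bessel_mapping_def by blast
  then have "(\<integral>\<^sup>+x. ennreal ((cmod (cinner f (F x)))\<^sup>2) \<partial>M) < \<infinity>"
    using ennreal_less_top le_less_trans by fastforce
  then show "integrable M (\<lambda>x. (cmod (cinner f (F x)))\<^sup>2)"
    by (intro integrableI_bounded) simp_all
qed

lemma bessel_nn_integral:
  assumes "bessel_mapping M F"
  shows "(\<integral>\<^sup>+x. ennreal ((cmod (cinner f (F x)))\<^sup>2) \<partial>M)
    = ennreal (\<integral>x. (cmod (cinner f (F x)))\<^sup>2 \<partial>M)"
  using bessel_square_integrable[OF assms]
  by (intro nn_integral_eq_integral) (simp_all add: square_integrable_def)

lemma bessel_bound:
  assumes "bessel_mapping M F"
  shows "\<exists>B\<ge>0. \<forall>f. (\<integral>x. (cmod (cinner f (F x)))\<^sup>2 \<partial>M) \<le> B * (norm f)\<^sup>2"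
proof -
  obtain B where "B \<ge> 0"
    "\<And>f. ennreal (\<integral>x. (cmod (cinner f (F x)))\<^sup>2 \<partial>M) \<le> ennreal (B * (norm f)\<^sup>2)"
    using assms unfolding bessel_nn_integral[OF assms, symmetric] bessel_mapping_def by blast
  then show ?thesis
    by (auto simp: ennreal_le_iff)
qed

lemma has_weak_integral_unique:
  "has_weak_integral M G h \<Longrightarrow> has_weak_integral M G k \<Longrightarrow> h = k"
  unfolding has_weak_integral_def by (metis cinner_eqI)

lemma weak_integral_eqI: "has_weak_integral M G h \<Longrightarrow> weak_integral M G = h"
  unfolding weak_integral_def by (rule the_equality) (assumption, rule has_weak_integral_unique)

lemma cinner_scaleC_left_cnj:
  "cinner (c *\<^sub>C F) g = c * cnj (cinner (g::'a::complex_inner) F)"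
  by (simp add: cinner_scaleC_left cinner_commute[of F g])

text \<open>By the Cauchy-Schwarz inequality in \<open>L2\<close> and the Bessel bound, the right-hand side of the
  defining identity of the weak integral is a bounded conjugate linear functional of \<open>g\<close>, which
  the Riesz theorem represents by a vector.\<close>

lemma bessel_weak_integral_exists:
  assumes F: "bessel_mapping M F" and \<phi>: "square_integrable M \<phi>"
  shows "\<exists>h. has_weak_integral M (\<lambda>x. \<phi> x *\<^sub>C F x) h"
proof -
  obtain B where B: "B \<ge> 0" "\<And>f. (\<integral>x. (cmod (cinner f (F x)))\<^sup>2 \<partial>M) \<le> B * (norm f)\<^sup>2"
    using bessel_bound[OF F] by blast
  define L where "L g = (\<integral>x. \<phi> x * cnj (cinner g (F x)) \<partial>M)" for g
  have int: "integrable M (\<lambda>x. \<phi> x * cnj (cinner g (F x)))" for g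
    by (rule square_integrable_mult_cnj[OF \<phi> bessel_square_integrable[OF F]])
  have "\<exists>h. \<forall>g. cinner h g = L g"
  proof (rule riesz_representation)
    show "L (x + y) = L x + L y" for x y
      unfolding L_def using int by (simp add: cinner_add_left distrib_left)
    have "(\<integral>x. cnj c * (\<phi> x * cnj (cinner g (F x))) \<partial>M) = cnj c * L g" for c g
      unfolding L_def by simp
    then show "L (c *\<^sub>C g) = cnj c * L g" for c g
      unfolding L_def by (simp add: cinner_scaleC_left mult.left_commute)
    show "cmod (L g) \<le> sqrt (\<integral>x. (cmod (\<phi> x))\<^sup>2 \<partial>M) * sqrt B * norm g" for g
    proof -
      have "cmod (L g) \<le> sqrt (\<integral>x. (cmod (\<phi> x))\<^sup>2 \<partial>M) * sqrt (\<integral>x. (cmod (cinner g (F x)))\<^sup>2 \<partial>M)"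
        unfolding L_def by (rule L2_pairing_cauchy_schwarz[OF \<phi> bessel_square_integrable[OF F]])
      also have "\<dots> \<le> sqrt (\<integral>x. (cmod (\<phi> x))\<^sup>2 \<partial>M) * sqrt (B * (norm g)\<^sup>2)"
        by (intro mult_left_mono real_sqrt_le_mono B(2)) simp
      finally show ?thesis
        by (simp add: real_sqrt_mult mult.assoc)
    qed
  qed
  then show ?thesis
    using int by (simp add: has_weak_integral_def cinner_scaleC_left_cnj L_def) metis
qed

text \<open>\<open>synthesis_op\<close> integrates a chosen representative of a class; by this congruence the
  choice is immaterial.\<close>

lemma has_weak_integral_cong_AE:
  assumes F: "bessel_mapping M F"
    and \<phi>: "square_integrable M \<phi>" and \<psi>: "square_integrable M \<psi>" and eq: "AE x in M. \<phi> x = \<psi> x"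
    and h: "has_weak_integral M (\<lambda>x. \<phi> x *\<^sub>C F x) h"
  shows "has_weak_integral M (\<lambda>x. \<psi> x *\<^sub>C F x) h"
proof -
  have "(\<integral>x. \<phi> x * cnj (cinner g (F x)) \<partial>M) = (\<integral>x. \<psi> x * cnj (cinner g (F x)) \<partial>M)" for g
  proof (rule integral_cong_AE)
    note [measurable] = \<phi>[THEN square_integrable_measurable] \<psi>[THEN square_integrable_measurable]
      bessel_square_integrable[OF F, THEN square_integrable_measurable]
    show "(\<lambda>x. \<phi> x * cnj (cinner g (F x))) \<in> borel_measurable M"
      "(\<lambda>x. \<psi> x * cnj (cinner g (F x))) \<in> borel_measurable M"
      by measurable
    show "AE x in M. \<phi> x * cnj (cinner g (F x)) = \<psi> x * cnj (cinner g (F x))"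
      using eq by eventually_elim simp
  qed
  then show ?thesis
    using h square_integrable_mult_cnj[OF \<psi> bessel_square_integrable[OF F]]
    by (simp add: has_weak_integral_def cinner_scaleC_left_cnj)
qed

lemma synthesis_op_weak_integral:
  assumes F: "bessel_mapping M F" and \<phi>: "square_integrable M \<phi>"
  shows "has_weak_integral M (\<lambda>x. \<phi> x *\<^sub>C F x) (synthesis_op M F (L2_class M \<phi>))"
proof -
  note rep = L2_rep_L2_class[OF \<phi>]
  obtain h where h: "has_weak_integral M (\<lambda>x. L2_rep (L2_class M \<phi>) x *\<^sub>C F x) h"
    using bessel_weak_integral_exists[OF F rep(1)] by blast
  then have "synthesis_op M F (L2_class M \<phi>) = h"
    unfolding synthesis_op_def by (rule weak_integral_eqI)
  then show ?thesis
    using has_weak_integral_cong_AE[OF F rep(1) \<phi> rep(2) h] by simp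
qed

lemma cinner_synthesis_op:
  assumes "bessel_mapping M F" and "square_integrable M \<phi>"
  shows "cinner (synthesis_op M F (L2_class M \<phi>)) g = (\<integral>x. \<phi> x * cnj (cinner g (F x)) \<partial>M)"
  using synthesis_op_weak_integral[OF assms]
  by (simp add: has_weak_integral_def cinner_scaleC_left_cnj)

lemma cinner_synthesis_op_L2:
  assumes "bessel_mapping M F" and a: "a \<in> L2 M"
  shows "cinner (synthesis_op M F a) g = (\<integral>x. L2_rep a x * cnj (cinner g (F x)) \<partial>M)"
  using cinner_synthesis_op[OF assms(1) L2_rep_square_integrable[OF a]] L2_class_L2_rep[OF a]
  by simp

text \<open>Testing \<open>h = synthesis_op M F a\<close> against itself bounds \<open>(norm h)\<^sup>2\<close> by a multiple of
  \<open>norm h\<close>.\<close>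

lemma synthesis_op_bounded:
  assumes F: "bessel_mapping M F"
  shows "\<exists>K\<ge>0. \<forall>a\<in>L2 M. norm (synthesis_op M F a) \<le> K * L2_norm M a"
proof -
  obtain B where B: "B \<ge> 0" "\<And>f. (\<integral>x. (cmod (cinner f (F x)))\<^sup>2 \<partial>M) \<le> B * (norm f)\<^sup>2"
    using bessel_bound[OF F] by blast
  have "norm (synthesis_op M F a) \<le> sqrt B * L2_norm M a" if a: "a \<in> L2 M" for a
  proof -
    define h where "h = synthesis_op M F a"
    have "(norm h)\<^sup>2 = cmod (cinner h h)"
      by (simp add: cinner_self norm_power)
    also have "\<dots> \<le> L2_norm M a * sqrt (\<integral>x. (cmod (cinner h (F x)))\<^sup>2 \<partial>M)"
      using L2_pairing_cauchy_schwarz[OF L2_rep_square_integrable[OF a]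
          bessel_square_integrable[OF F, of h]]
      by (simp add: h_def cinner_synthesis_op_L2[OF F a, of "synthesis_op M F a"] L2_norm_def)
    also have "\<dots> \<le> L2_norm M a * sqrt (B * (norm h)\<^sup>2)"
      by (intro mult_left_mono real_sqrt_le_mono B(2)) (simp add: L2_norm_def)
    finally have "norm h * norm h \<le> (sqrt B * L2_norm M a) * norm h"
      by (simp add: real_sqrt_mult power2_eq_square mult_ac)
    moreover have "0 \<le> sqrt B * L2_norm M a"
      using B(1) by (simp add: L2_norm_def)
    ultimately show ?thesis
      unfolding h_def[symmetric] by (cases "h = 0") simp_all
  qed
  then show ?thesis
    using B(1) by (intro exI[of _ "sqrt B"]) simp
qed

lemma synthesis_op_bounded_clinear:
  assumes F: "bessel_mapping M F"
  shows "L2_bounded_clinear M (synthesis_op M F)"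
  unfolding L2_bounded_clinear_def
proof (intro conjI ballI allI)
  note sq = L2_rep_square_integrable and Fsq = bessel_square_integrable[OF F]
  show "synthesis_op M F (L2_add M a b) = synthesis_op M F a + synthesis_op M F b"
    if "a \<in> L2 M" "b \<in> L2 M" for a b
    unfolding L2_add_def
    by (rule cinner_eqI)
      (use that square_integrable_mult_cnj[OF sq Fsq] in \<open>simp add: cinner_add_left
        cinner_synthesis_op_L2[OF F] cinner_synthesis_op[OF F square_integrable_add[OF sq sq]]
        distrib_right\<close>)
  show "synthesis_op M F (L2_scale M c a) = c *\<^sub>C synthesis_op M F a" if "a \<in> L2 M" for c a
    unfolding L2_scale_def
    by (rule cinner_eqI)
      (use that in \<open>simp add: cinner_scaleC_left cinner_synthesis_op_L2[OF F]
        cinner_synthesis_op[OF F square_integrable_scale[OF sq]] mult.assoc\<close>)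
  show "\<exists>K. \<forall>a\<in>L2 M. norm (synthesis_op M F a) \<le> K * L2_norm M a"
    using synthesis_op_bounded[OF F] by blast
qed

lemma is_L2_adjoint_unique:
  assumes "is_L2_adjoint M T A" "is_L2_adjoint M T A'"
  shows "A = A'"
proof
  fix f
  show "A f = A' f"
    by (rule L2_inner_ext[of _ M]) (use assms in \<open>auto simp: is_L2_adjoint_def\<close>)
qed

lemma synthesis_op_adjoint:
  assumes F: "bessel_mapping M F"
  shows "is_L2_adjoint M (synthesis_op M F) (\<lambda>f. L2_class M (\<lambda>x. cinner f (F x)))"
  unfolding is_L2_adjoint_def
proof (intro conjI allI ballI)
  note Fsq = bessel_square_integrable[OF F]
  show "L2_class M (\<lambda>x. cinner f (F x)) \<in> L2 M" for f
    by (rule L2_class_in_L2[OF Fsq])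
  show "cinner (synthesis_op M F a) f = L2_inner M a (L2_class M (\<lambda>x. cinner f (F x)))"
    if a: "a \<in> L2 M" for a f
    using L2_inner_class[OF L2_rep_square_integrable[OF a] Fsq]
    by (simp add: L2_class_L2_rep[OF a] cinner_synthesis_op_L2[OF F a])
qed

lemma analysis_op_eq:
  assumes "bessel_mapping M F"
  shows "analysis_op M F = (\<lambda>f. L2_class M (\<lambda>x. cinner f (F x)))"
  unfolding analysis_op_def L2_adjoint_def
  by (rule the_equality[where P = "is_L2_adjoint M (synthesis_op M F)"])
    (use synthesis_op_adjoint[OF assms] is_L2_adjoint_unique in blast)+

section \<open>Frame operators\<close>

lemma cinner_frame_op:
  assumes "bessel_mapping M F"
  shows "cinner (frame_op M F f) g = (\<integral>x. cinner f (F x) * cnj (cinner g (F x)) \<partial>M)"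
  by (simp add: frame_op_def analysis_op_eq[OF assms]
      cinner_synthesis_op[OF assms bessel_square_integrable[OF assms]])

lemma frame_op_selfadjoint:
  assumes "bessel_mapping M F"
  shows "cinner (frame_op M F f) g = cinner f (frame_op M F g)"
proof -
  have "cinner f (frame_op M F g) = cnj (\<integral>x. cinner g (F x) * cnj (cinner f (F x)) \<partial>M)"
    unfolding cinner_frame_op[OF assms, symmetric] by (rule cinner_commute)
  also have "\<dots> = (\<integral>x. cnj (cinner g (F x) * cnj (cinner f (F x))) \<partial>M)"
    by (rule Bochner_Integration.integral_cnj[symmetric])
  also have "\<dots> = cinner (frame_op M F f) g"
    by (simp only: cinner_frame_op[OF assms] complex_cnj_mult complex_cnj_cnj mult.commute)
  finally show ?thesis ..
qed

lemma frame_op_bounded_clinear: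
  assumes F: "bessel_mapping M F"
  shows "bounded_clinear (frame_op M F)"
proof -
  note Fsq = bessel_square_integrable[OF F] and int = square_integrable_mult_cnj[OF Fsq Fsq]
  obtain B where B: "B \<ge> 0" "\<And>f. (\<integral>x. (cmod (cinner f (F x)))\<^sup>2 \<partial>M) \<le> B * (norm f)\<^sup>2"
    using bessel_bound[OF F] by blast
  obtain K where K: "K \<ge> 0" "\<And>a. a \<in> L2 M \<Longrightarrow> norm (synthesis_op M F a) \<le> K * L2_norm M a"
    using synthesis_op_bounded[OF F] by blast
  have scale: "frame_op M F (c *\<^sub>C f) = c *\<^sub>C frame_op M F f" for c f
    by (rule cinner_eqI) (simp add: cinner_frame_op[OF F] cinner_scaleC_left mult.assoc)
  have "norm (frame_op M F f) \<le> norm f * (K * sqrt B)" for f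
  proof -
    have "L2_norm M (analysis_op M F f) = sqrt (\<integral>x. (cmod (cinner f (F x)))\<^sup>2 \<partial>M)"
    proof -
      note rep = L2_rep_L2_class[OF Fsq[of f]]
      have "(\<integral>x. (cmod (L2_rep (L2_class M (\<lambda>x. cinner f (F x))) x))\<^sup>2 \<partial>M)
          = (\<integral>x. (cmod (cinner f (F x)))\<^sup>2 \<partial>M)"
      proof (rule integral_cong_AE)
        note [measurable] = rep(1)[THEN square_integrable_measurable] Fsq[THEN square_integrable_measurable]
        show "(\<lambda>x. (cmod (L2_rep (L2_class M (\<lambda>x. cinner f (F x))) x))\<^sup>2) \<in> borel_measurable M"
          "(\<lambda>x. (cmod (cinner f (F x)))\<^sup>2) \<in> borel_measurable M"
          by measurable
        show "AE x in M. (cmod (L2_rep (L2_class M (\<lambda>x. cinner f (F x))) x))\<^sup>2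
            = (cmod (cinner f (F x)))\<^sup>2"
          using rep(2) by eventually_elim simp
      qed
      then show ?thesis
        by (simp add: L2_norm_def analysis_op_eq[OF F])
    qed
    also have "\<dots> \<le> sqrt (B * (norm f)\<^sup>2)"
      by (rule real_sqrt_le_mono[OF B(2)])
    finally have "L2_norm M (analysis_op M F f) \<le> sqrt B * norm f"
      by (simp add: real_sqrt_mult)
    then have "K * L2_norm M (analysis_op M F f) \<le> K * (sqrt B * norm f)"
      by (rule mult_left_mono[OF _ K(1)])
    moreover have "norm (frame_op M F f) \<le> K * L2_norm M (analysis_op M F f)"
      using K(2)[of "analysis_op M F f"] by (simp add: frame_op_def analysis_op_eq[OF F] L2_class_in_L2 Fsq)
    ultimately show ?thesis
      by (simp add: mult_ac)
  qed
  moreover have "frame_op M F (f + g) = frame_op M F f + frame_op M F g" for f g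
    by (rule cinner_eqI)
      (use int in \<open>simp add: cinner_frame_op[OF F] cinner_add_left distrib_right\<close>)
  ultimately have "bounded_linear (frame_op M F)"
    by (intro bounded_linear_intro) (simp_all add: scaleR_scaleC scale)
  then show ?thesis
    by (simp add: bounded_clinear_def scale)
qed

lemma continuous_frame_bessel: "continuous_frame M F \<Longrightarrow> bessel_mapping M F"
  unfolding continuous_frame_def bessel_mapping_def by blast

text \<open>The lower frame bound is coercivity of the frame operator.\<close>

lemma frame_op_bij:
  assumes F: "continuous_frame M F"
  shows "bij (frame_op M F)"
proof -
  note bF = continuous_frame_bessel[OF F]
  note Fsq = bessel_square_integrable[OF bF]
  obtain A where A: "A > 0"
      "\<And>f. ennreal (A * (norm f)\<^sup>2) \<le> (\<integral>\<^sup>+x. ennreal ((cmod (cinner f (F x)))\<^sup>2) \<partial>M)"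
    using F unfolding continuous_frame_def by blast
  have "A * (norm f)\<^sup>2 \<le> Re (cinner (frame_op M F f) f)" for f
  proof -
    have "cinner (frame_op M F f) f = (\<integral>x. complex_of_real ((cmod (cinner f (F x)))\<^sup>2) \<partial>M)"
      by (simp only: cinner_frame_op[OF bF] complex_norm_square)
    then have "Re (cinner (frame_op M F f) f) = (\<integral>x. (cmod (cinner f (F x)))\<^sup>2 \<partial>M)"
      by (simp only: integral_complex_of_real Re_complex_of_real)
    moreover have "ennreal (A * (norm f)\<^sup>2) \<le> ennreal (\<integral>x. (cmod (cinner f (F x)))\<^sup>2 \<partial>M)"
      using A(2)[of f] unfolding bessel_nn_integral[OF bF] .
    ultimately show ?thesis
      by (simp add: ennreal_le_iff)
  qed
  moreover have "bounded_linear (frame_op M F)"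
    using frame_op_bounded_clinear[OF bF] by (simp add: bounded_clinear_def)
  ultimately show ?thesis
    by (intro coercive_selfadjoint_bij[OF _ frame_op_selfadjoint[OF bF] A(1)])
qed

text \<open>Both frame bounds pass from a dense set to the whole space.  For the upper bound this is
  Fatou's lemma.  The lower bound needs the upper one to control the error of approximation:
  integrating \<open>\<bar>a\<bar>\<^sup>2 \<le> 2 \<bar>b\<bar>\<^sup>2 + 2 \<bar>a - b\<bar>\<^sup>2\<close> compares the approximant with its limit, at the
  cost of a factor of two in the constant.\<close>

lemma continuous_frame_if_dense:
  fixes F :: "'x \<Rightarrow> 'h::chilbert_space"
  assumes meas: "weakly_measurable M F" and dense: "closure D = UNIV"
    and A: "A > 0" and B: "B \<ge> 0"
    and lower: "\<And>f. f \<in> D \<Longrightarrow>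
      ennreal (A * (norm f)\<^sup>2) \<le> (\<integral>\<^sup>+x. ennreal ((cmod (cinner f (F x)))\<^sup>2) \<partial>M)"
    and upper: "\<And>f. f \<in> D \<Longrightarrow>
      (\<integral>\<^sup>+x. ennreal ((cmod (cinner f (F x)))\<^sup>2) \<partial>M) \<le> ennreal (B * (norm f)\<^sup>2)"
  shows "continuous_frame M F"
proof -
  have [measurable]: "(\<lambda>x. cinner f (F x)) \<in> borel_measurable M" for f
    using meas by (simp add: weakly_measurable_def)
  have approx: "\<exists>g. (\<forall>n. g n \<in> D) \<and> g \<longlonglongrightarrow> f" for f
    using dense closure_sequential[of f D] by auto
  have upper_all: "(\<integral>\<^sup>+x. ennreal ((cmod (cinner f (F x)))\<^sup>2) \<partial>M) \<le> ennreal (B * (norm f)\<^sup>2)" for f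
  proof -
    obtain g where gD: "\<And>n. g n \<in> D" and g: "g \<longlonglongrightarrow> f"
      using approx by blast
    have "(\<lambda>n. ennreal ((cmod (cinner (g n) (F x)))\<^sup>2))
        \<longlonglongrightarrow> ennreal ((cmod (cinner f (F x)))\<^sup>2)" for x
      by (intro tendsto_ennrealI tendsto_power tendsto_norm cinner.tendsto tendsto_const g)
    then have "(\<integral>\<^sup>+x. ennreal ((cmod (cinner f (F x)))\<^sup>2) \<partial>M)
        = (\<integral>\<^sup>+x. liminf (\<lambda>n. ennreal ((cmod (cinner (g n) (F x)))\<^sup>2)) \<partial>M)"
      by (intro nn_integral_cong lim_imp_Liminf[symmetric]) simp_all
    also have "\<dots> \<le> liminf (\<lambda>n. \<integral>\<^sup>+x. ennreal ((cmod (cinner (g n) (F x)))\<^sup>2) \<partial>M)"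
      by (rule nn_integral_liminf) measurable
    also have "\<dots> \<le> liminf (\<lambda>n. ennreal (B * (norm (g n))\<^sup>2))"
      by (intro Liminf_mono always_eventually allI upper gD)
    also have "\<dots> = ennreal (B * (norm f)\<^sup>2)"
      by (intro lim_imp_Liminf tendsto_ennrealI tendsto_intros g) simp
    finally show ?thesis .
  qed
  have F: "bessel_mapping M F"
    using meas B upper_all by (auto simp: bessel_mapping_def)
  define Q where "Q f = (\<integral>x. (cmod (cinner f (F x)))\<^sup>2 \<partial>M)" for f
  note Q = bessel_nn_integral[OF F, folded Q_def]
  have int: "integrable M (\<lambda>x. (cmod (cinner f (F x)))\<^sup>2)" for f
    using bessel_square_integrable[OF F] by (simp add: square_integrable_def)
  have Q_upper: "Q f \<le> B * (norm f)\<^sup>2" for f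
    using upper_all[of f] B by (simp add: Q ennreal_le_iff)
  have Q_nonneg: "0 \<le> Q f" for f
    by (simp add: Q_def)
  have Q_lower: "A * (norm f)\<^sup>2 \<le> Q f" if "f \<in> D" for f
    using lower[OF that] Q_nonneg[of f] by (simp add: Q ennreal_le_iff)
  have Q_diff: "Q g \<le> 2 * Q f + 2 * Q (g - f)" for f g
  proof -
    have "(cmod a)\<^sup>2 \<le> 2 * (cmod b)\<^sup>2 + 2 * (cmod (a - b))\<^sup>2" for a b
    proof -
      have "(cmod a)\<^sup>2 \<le> (cmod b + cmod (a - b))\<^sup>2"
        using norm_triangle_ineq[of b "a - b"] by (intro power_mono) simp_all
      then show ?thesis
        using zero_le_power2[of "cmod b - cmod (a - b)"] unfolding power2_sum power2_diff by linarith
    qed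
    note pointwise = this[of "cinner g (F x)" "cinner f (F x)" for x, folded cinner.diff_left]
    have "Q g \<le> (\<integral>x. 2 * (cmod (cinner f (F x)))\<^sup>2 + 2 * (cmod (cinner (g - f) (F x)))\<^sup>2 \<partial>M)"
      unfolding Q_def
      by (rule integral_mono[OF int _ pointwise])
        (intro Bochner_Integration.integrable_add integrable_mult_right int)
    also have "\<dots> = 2 * Q f + 2 * Q (g - f)"
      unfolding Q_def using int by simp
    finally show ?thesis .
  qed
  have "A / 2 * (norm f)\<^sup>2 \<le> Q f" for f
  proof -
    obtain g where gD: "\<And>n. g n \<in> D" and g: "g \<longlonglongrightarrow> f"
      using approx by blast
    have "A * (norm (g n))\<^sup>2 \<le> 2 * Q f + 2 * (B * (norm (g n - f))\<^sup>2)" for n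
      using Q_lower[OF gD[of n]] Q_diff[of "g n" f] Q_upper[of "g n - f"] by linarith
    moreover have "(\<lambda>n. A * (norm (g n))\<^sup>2) \<longlonglongrightarrow> A * (norm f)\<^sup>2"
      by (intro tendsto_intros g)
    moreover have "(\<lambda>n. 2 * Q f + 2 * (B * (norm (g n - f))\<^sup>2))
        \<longlonglongrightarrow> 2 * Q f + 2 * (B * (norm (f - f))\<^sup>2)"
      by (intro tendsto_intros g)
    ultimately have "A * (norm f)\<^sup>2 \<le> 2 * Q f + 2 * (B * (norm (f - f))\<^sup>2)"
      by (intro LIMSEQ_le[of _ _ "\<lambda>n. 2 * Q f + 2 * (B * (norm (g n - f))\<^sup>2)"]) auto
    then show ?thesis
      by simp
  qed
  then have "ennreal (A / 2 * (norm f)\<^sup>2) \<le> (\<integral>\<^sup>+x. ennreal ((cmod (cinner f (F x)))\<^sup>2) \<partial>M)" for f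
    unfolding Q by (rule ennreal_leI)
  then show ?thesis
    unfolding continuous_frame_def using meas upper_all A B half_gt_zero by blast
qed

section \<open>Hilbert space tensor products\<close>

lemma cinner_tensor:
  "hilbert_tensor t \<Longrightarrow> cinner (t u v) (t u' v') = cinner u u' * cinner v v'"
  by (simp add: hilbert_tensor_def)

lemma tensor_scaleC_left: "hilbert_tensor t \<Longrightarrow> t (c *\<^sub>C u) v = c *\<^sub>C t u v"
  by (simp add: hilbert_tensor_def)

lemma tensor_scaleC_right: "hilbert_tensor t \<Longrightarrow> t u (c *\<^sub>C v) = c *\<^sub>C t u v"
  by (simp add: hilbert_tensor_def)

lemma tensor_dense: "hilbert_tensor t \<Longrightarrow> closure (span {t u v |u v. True}) = UNIV"
  by (simp add: hilbert_tensor_def)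

lemma norm_tensor:
  assumes "hilbert_tensor t"
  shows "norm (t u v) = norm u * norm v"
proof -
  have "complex_of_real ((norm (t u v))\<^sup>2) = complex_of_real ((norm u * norm v)\<^sup>2)"
    using cinner_tensor[OF assms, of u v u v] by (simp add: cinner_self power_mult_distrib)
  then have "(norm (t u v))\<^sup>2 = (norm u * norm v)\<^sup>2"
    by (simp only: of_real_eq_iff)
  then show ?thesis
    by (rule power2_eq_imp_eq) simp_all
qed

lemma bounded_bilinear_tensor:
  fixes t :: "'a::chilbert_space \<Rightarrow> 'b::chilbert_space \<Rightarrow> 'c::chilbert_space"
  assumes "hilbert_tensor t"
  shows "bounded_bilinear t"
proof
  show "\<exists>K. \<forall>a b. norm (t a b) \<le> norm a * norm b * K"
    by (rule exI[of _ 1]) (simp add: norm_tensor[OF assms])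
  show "t (a + a') b = t a b + t a' b" "t a (b + b') = t a b + t a b'" for a a' b b'
    using assms by (simp_all add: hilbert_tensor_def)
  show "t (r *\<^sub>R a) b = r *\<^sub>R t a b" "t a (r *\<^sub>R b) = r *\<^sub>R t a b" for r a b
    by (simp_all only: scaleR_scaleC tensor_scaleC_left[OF assms] tensor_scaleC_right[OF assms])
qed

text \<open>A bounded functional that vanishes on elementary tensors vanishes on their closed span.\<close>

lemma tensor_eqI:
  assumes t: "hilbert_tensor t" and eq: "\<And>u v. cinner x (t u v) = cinner y (t u v)"
  shows "x = y"
proof -
  have lin: "bounded_linear (\<lambda>z. cinner (x - y) z)"
    by (rule cinner.bounded_linear_right)
  have "cinner (x - y) z = 0" if "z \<in> span {t u v |u v. True}" for z
    by (rule linear_eq_0_on_span[OF bounded_linear.linear[OF lin] _ that])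
      (auto simp: cinner.diff_left eq)
  moreover have "closed {z. cinner (x - y) z = 0}"
    by (intro closed_Collect_eq continuous_intros linear_continuous_on lin)
  ultimately have "closure (span {t u v |u v. True}) \<subseteq> {z. cinner (x - y) z = 0}"
    by (intro closure_minimal) auto
  then have "cinner (x - y) z = 0" for z
    unfolding tensor_dense[OF t] by auto
  then show ?thesis
    unfolding cinner.diff_left by (intro cinner_eqI[of x y]) (simp only: right_minus_eq)
qed

text \<open>Finite sums of elementary tensors can be rewritten with orthonormal second factors.  This
  is a Gram-Schmidt step: when a tensor \<open>t u v\<close> is added, the projection of \<open>v\<close> onto the vectors
  already present only changes their coefficients, and the remainder, if nonzero, contributes one
  new unit vector.\<close>

lemma span_tensor_orthonormal:
  fixes t :: "'a::chilbert_space \<Rightarrow> 'b::chilbert_space \<Rightarrow> 'c::chilbert_space"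
  assumes t: "hilbert_tensor t" and f: "f \<in> span {t u v |u v. True}"
  shows "\<exists>E w. finite E \<and> (\<forall>e\<in>E. norm e = 1) \<and>
    (\<forall>e\<in>E. \<forall>e'\<in>E. e \<noteq> e' \<longrightarrow> cinner e e' = 0) \<and> f = (\<Sum>e\<in>E. t (w e) e)"
  using f
proof (induction rule: span_induct_alt)
  case base
  show ?case
    by (rule exI[of _ "{}"]) simp
next
  case (step c x y)
  interpret t: bounded_bilinear t
    by (rule bounded_bilinear_tensor[OF t])
  obtain u v where x: "x = t u v"
    using step(1) by (auto simp only: mem_Collect_eq)
  obtain E w where fin: "finite E" and unit: "\<forall>e\<in>E. norm e = 1"
    and orthogonal: "\<forall>e\<in>E. \<forall>e'\<in>E. e \<noteq> e' \<longrightarrow> cinner e e' = 0"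
    and y: "y = (\<Sum>e\<in>E. t (w e) e)"
    using step(2) by (elim exE conjE)
  note E = fin unit[rule_format] orthogonal[rule_format]
  define p where "p = (\<Sum>e\<in>E. cinner v e *\<^sub>C e)"
  define r where "r = v - p"
  define w' where "w' e = c *\<^sub>R (cinner v e *\<^sub>C u) + w e" for e
  have "cinner p e = cinner v e" if e: "e \<in> E" for e
  proof -
    have "cinner p e = (\<Sum>e'\<in>E. cinner v e' * cinner e' e)"
      by (simp add: p_def cinner.sum_left cinner_scaleC_left)
    also have "\<dots> = (\<Sum>e'\<in>E. if e' = e then cinner v e else 0)"
      by (intro sum.cong refl) (use E(2,3) e in \<open>auto simp: cinner_self\<close>)
    also have "\<dots> = cinner v e"
      using E(1) e by simp
    finally show ?thesis .
  qed
  then have r: "cinner r e = 0" if "e \<in> E" for e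
    using that by (simp add: r_def cinner.diff_left)
  have "t u p = (\<Sum>e\<in>E. t (cinner v e *\<^sub>C u) e)"
    by (simp add: p_def t.sum_right tensor_scaleC_left[OF t] tensor_scaleC_right[OF t])
  moreover have "t u v = t u p + t u r"
    by (simp add: r_def t.add_right[symmetric])
  ultimately have split: "c *\<^sub>R x + y = (\<Sum>e\<in>E. t (w' e) e) + c *\<^sub>R t u r"
    by (simp add: x y w'_def t.add_left t.scaleR_left sum.distrib scaleR_add_right scaleR_sum_right)
  show ?case
  proof (cases "r = 0")
    case True
    then show ?thesis
      using fin unit orthogonal split by (intro exI[of _ E] exI[of _ w']) (simp add: t.zero_right)
  next
    case False
    define e0 where "e0 = (1 / norm r) *\<^sub>R r"
    have e0: "norm e0 = 1"
      using False by (simp add: e0_def)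
    have orth: "cinner e0 e = 0" "cinner e e0 = 0" if "e \<in> E" for e
      using r[OF that] cinner_commute[of e e0] by (simp_all add: e0_def cinner.scaleR_left)
    have e0_notin: "e0 \<notin> E"
      using orth(1)[of e0] e0 by (auto simp: cinner_self)
    define w'' where "w'' = w'(e0 := (c * norm r) *\<^sub>R u)"
    have "(\<Sum>e\<in>E. t (w'' e) e) = (\<Sum>e\<in>E. t (w' e) e)"
      by (rule sum.cong) (use e0_notin in \<open>auto simp: w''_def\<close>)
    moreover have "t (w'' e0) e0 = c *\<^sub>R t u r"
      using False by (simp add: w''_def e0_def t.scaleR_left t.scaleR_right)
    ultimately have "c *\<^sub>R x + y = (\<Sum>e\<in>insert e0 E. t (w'' e) e)"
      unfolding split sum.insert[OF fin e0_notin] by (simp only: add.commute)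
    moreover have "\<forall>e\<in>insert e0 E. norm e = 1"
      using unit e0 by blast
    moreover have "\<forall>e\<in>insert e0 E. \<forall>e'\<in>insert e0 E. e \<noteq> e' \<longrightarrow> cinner e e' = 0"
      by (intro ballI impI, elim insertE) (simp_all add: orth orthogonal)
    ultimately show ?thesis
      using finite.insertI[OF fin] by (intro exI[of _ "insert e0 E"] exI[of _ w''] conjI)
  qed
qed

section \<open>Tensor products of continuous frames\<close>

lemma cinner_tensor_map:
  "hilbert_tensor t \<Longrightarrow>
    cinner (t u v) (tensor_map t F1 F2 z) = cinner u (F1 (fst z)) * cinner v (F2 (snd z))"
  by (simp add: tensor_map_def case_prod_unfold cinner_tensor)

lemma weakly_measurable_tensor_map:
  fixes t :: "'a::chilbert_space \<Rightarrow> 'b::chilbert_space \<Rightarrow> 'c::chilbert_space"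
  assumes t: "hilbert_tensor t"
    and F1: "weakly_measurable M1 F1" and F2: "weakly_measurable M2 F2"
  shows "weakly_measurable (M1 \<Otimes>\<^sub>M M2) (tensor_map t F1 F2)"
  unfolding weakly_measurable_def
proof
  fix f
  \<comment> \<open>elementary tensors give products of measurable functions, finite sums give sums of these,
    and every other \<open>f\<close> gives a pointwise limit\<close>
  have [measurable]: "(\<lambda>x. cinner u (F1 x)) \<in> borel_measurable M1"
      "(\<lambda>x. cinner v (F2 x)) \<in> borel_measurable M2" for u v
    using F1 F2 by (simp_all add: weakly_measurable_def)
  have span: "(\<lambda>z. cinner g (tensor_map t F1 F2 z)) \<in> borel_measurable (M1 \<Otimes>\<^sub>M M2)"
    if "g \<in> span {t u v |u v. True}" for g
    using that
  proof (induction rule: span_induct_alt)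
    case base
    show ?case by (simp add: cinner.zero_left)
  next
    case (step c x y)
    then obtain u v where "x = t u v"
      by blast
    then have "(\<lambda>z. cinner x (tensor_map t F1 F2 z)) \<in> borel_measurable (M1 \<Otimes>\<^sub>M M2)"
      by (simp add: cinner_tensor_map[OF t])
    then show ?case
      using step.IH by (simp add: cinner_add_left cinner.scaleR_left)
  qed
  have "f \<in> closure (span {t u v |u v. True})"
    unfolding tensor_dense[OF t] by (rule UNIV_I)
  then obtain g where g: "\<And>n. g n \<in> span {t u v |u v. True}" "g \<longlonglongrightarrow> f"
    unfolding closure_sequential by blast
  show "(\<lambda>z. cinner f (tensor_map t F1 F2 z)) \<in> borel_measurable (M1 \<Otimes>\<^sub>M M2)"
    by (rule borel_measurable_LIMSEQ_metric[of "\<lambda>n z. cinner (g n) (tensor_map t F1 F2 z)"])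
      (intro span g(1), intro cinner.tendsto tendsto_const g(2))
qed

text \<open>Write \<open>f = (\<Sum>e\<in>E. t (w e) e)\<close> with \<open>E\<close> orthonormal.  For fixed \<open>x\<close> the inner product of \<open>f\<close>
  with \<open>F1 x \<otimes> F2 y\<close> is that of \<open>\<Sum>e\<in>E. \<langle>w e, F1 x\<rangle> e\<close> with \<open>F2 y\<close>.  So the frame inequality of
  \<open>F2\<close> compares the inner integral with \<open>\<Sum>e\<in>E. \<bar>\<langle>w e, F1 x\<rangle>\<bar>\<^sup>2\<close>, and the frame inequality of
  \<open>F1\<close>, applied to each \<open>w e\<close>, compares the outer integral with \<open>\<Sum>e\<in>E. (norm (w e))\<^sup>2\<close>, which is
  the square norm of \<open>f\<close>.\<close>

lemma tensor_frame_iterated_integral: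
  fixes t :: "'a::chilbert_space \<Rightarrow> 'b::chilbert_space \<Rightarrow> 'c::chilbert_space"
    and M1 :: "'x measure"
  assumes t: "hilbert_tensor t" and M2: "sigma_finite_measure M2"
    and F1: "weakly_measurable M1 F1" and F2: "weakly_measurable M2 F2"
    and f: "f \<in> span {t u v |u v. True}"
  obtains E :: "'b set" and w :: "'b \<Rightarrow> 'a" and g :: "'x \<Rightarrow> 'b"
  where "finite E" and "(norm f)\<^sup>2 = (\<Sum>e\<in>E. (norm (w e))\<^sup>2)"
    and "\<And>x. (norm (g x))\<^sup>2 = (\<Sum>e\<in>E. (cmod (cinner (w e) (F1 x)))\<^sup>2)"
    and "(\<integral>\<^sup>+z. ennreal ((cmod (cinner f (tensor_map t F1 F2 z)))\<^sup>2) \<partial>(M1 \<Otimes>\<^sub>M M2))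
      = (\<integral>\<^sup>+x. \<integral>\<^sup>+y. ennreal ((cmod (cinner (g x) (F2 y)))\<^sup>2) \<partial>M2 \<partial>M1)"
proof -
  interpret t: bounded_bilinear t
    by (rule bounded_bilinear_tensor[OF t])
  interpret M2: sigma_finite_measure M2 by (rule M2)
  obtain E w where fin: "finite E" and unit: "\<forall>e\<in>E. norm e = 1"
    and orthogonal: "\<forall>e\<in>E. \<forall>e'\<in>E. e \<noteq> e' \<longrightarrow> cinner e e' = 0"
    and f_eq: "f = (\<Sum>e\<in>E. t (w e) e)"
    using span_tensor_orthonormal[OF t f] by (elim exE conjE)
  note E = fin unit[rule_format] orthogonal[rule_format]
  define g where "g x = (\<Sum>e\<in>E. cinner (w e) (F1 x) *\<^sub>C e)" for x
  have "(norm f)\<^sup>2 = (\<Sum>e\<in>E. (norm (t (w e) e))\<^sup>2)"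
    unfolding f_eq by (rule pythagoras_sum) (use E in \<open>auto simp: cinner_tensor[OF t]\<close>)
  also have "\<dots> = (\<Sum>e\<in>E. (norm (w e))\<^sup>2)"
    using E(2) by (simp add: norm_tensor[OF t])
  finally have norm_f: "(norm f)\<^sup>2 = (\<Sum>e\<in>E. (norm (w e))\<^sup>2)" .
  have norm_g: "(norm (g x))\<^sup>2 = (\<Sum>e\<in>E. (cmod (cinner (w e) (F1 x)))\<^sup>2)" for x
  proof -
    have "(norm (g x))\<^sup>2 = (\<Sum>e\<in>E. (norm (cinner (w e) (F1 x) *\<^sub>C e))\<^sup>2)"
      unfolding g_def
      by (rule pythagoras_sum) (use E in \<open>auto simp: cinner_scaleC_left cinner_scaleC_right\<close>)
    then show ?thesis
      using E(2) by (simp add: norm_scaleC)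
  qed
  have fg: "cinner f (tensor_map t F1 F2 (x, y)) = cinner (g x) (F2 y)" for x y
    by (simp add: f_eq g_def cinner.sum_left cinner_tensor_map[OF t] cinner_scaleC_left)
  have "(\<lambda>z. cinner f (tensor_map t F1 F2 z)) \<in> borel_measurable (M1 \<Otimes>\<^sub>M M2)"
    using weakly_measurable_tensor_map[OF t F1 F2] by (simp add: weakly_measurable_def)
  then have "(\<integral>\<^sup>+z. ennreal ((cmod (cinner f (tensor_map t F1 F2 z)))\<^sup>2) \<partial>(M1 \<Otimes>\<^sub>M M2))
      = (\<integral>\<^sup>+x. \<integral>\<^sup>+y. ennreal ((cmod (cinner (g x) (F2 y)))\<^sup>2) \<partial>M2 \<partial>M1)"
    unfolding fg[symmetric] by (intro M2.nn_integral_fst[symmetric]) measurable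
  then show ?thesis
    by (rule that[OF fin norm_f norm_g])
qed

lemma nn_integral_weighted_sum:
  assumes "C \<ge> 0" "finite E" and [measurable]: "\<And>e. e \<in> E \<Longrightarrow> h e \<in> borel_measurable M"
    and "\<And>e x. 0 \<le> h e x"
  shows "(\<integral>\<^sup>+x. ennreal (C * (\<Sum>e\<in>E. h e x)) \<partial>M) = (\<Sum>e\<in>E. ennreal C * (\<integral>\<^sup>+x. ennreal (h e x) \<partial>M))"
proof -
  have "(\<integral>\<^sup>+x. ennreal (C * (\<Sum>e\<in>E. h e x)) \<partial>M) = (\<integral>\<^sup>+x. (\<Sum>e\<in>E. ennreal C * ennreal (h e x)) \<partial>M)"
    using assms by (simp add: ennreal_mult sum_nonneg sum_ennreal[symmetric] sum_distrib_left)
  also have "\<dots> = (\<Sum>e\<in>E. \<integral>\<^sup>+x. ennreal C * ennreal (h e x) \<partial>M)"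
    by (rule nn_integral_sum) measurable
  also have "\<dots> = (\<Sum>e\<in>E. ennreal C * (\<integral>\<^sup>+x. ennreal (h e x) \<partial>M))"
    by (intro sum.cong refl nn_integral_cmult) measurable
  finally show ?thesis .
qed

lemma continuous_frame_tensor_map:
  fixes t :: "'a::chilbert_space \<Rightarrow> 'b::chilbert_space \<Rightarrow> 'c::chilbert_space"
  assumes t: "hilbert_tensor t" and M2: "sigma_finite_measure M2"
    and F1: "continuous_frame (M1 :: 'x measure) F1" and F2: "continuous_frame M2 F2"
  shows "continuous_frame (M1 \<Otimes>\<^sub>M M2) (tensor_map t F1 F2)"
proof -
  have meas: "weakly_measurable M1 F1" "weakly_measurable M2 F2"
    using F1 F2 by (simp_all add: continuous_frame_def)
  have [measurable]: "(\<lambda>x. cinner u (F1 x)) \<in> borel_measurable M1" for u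
    using meas by (simp add: weakly_measurable_def)
  obtain A1 B1 where 1: "A1 > 0" "B1 \<ge> 0"
    "\<And>f. ennreal (A1 * (norm f)\<^sup>2) \<le> (\<integral>\<^sup>+x. ennreal ((cmod (cinner f (F1 x)))\<^sup>2) \<partial>M1)"
    "\<And>f. (\<integral>\<^sup>+x. ennreal ((cmod (cinner f (F1 x)))\<^sup>2) \<partial>M1) \<le> ennreal (B1 * (norm f)\<^sup>2)"
    using F1 unfolding continuous_frame_def by blast
  obtain A2 B2 where 2: "A2 > 0" "B2 \<ge> 0"
    "\<And>f. ennreal (A2 * (norm f)\<^sup>2) \<le> (\<integral>\<^sup>+x. ennreal ((cmod (cinner f (F2 x)))\<^sup>2) \<partial>M2)"
    "\<And>f. (\<integral>\<^sup>+x. ennreal ((cmod (cinner f (F2 x)))\<^sup>2) \<partial>M2) \<le> ennreal (B2 * (norm f)\<^sup>2)"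
    using F2 unfolding continuous_frame_def by blast
  show ?thesis
  proof (rule continuous_frame_if_dense[OF weakly_measurable_tensor_map[OF t meas] tensor_dense[OF t]])
    show "A2 * A1 > 0" "B2 * B1 \<ge> 0"
      using 1 2 by simp_all
    fix f :: 'c assume f: "f \<in> span {t u v |u v. True}"
    obtain E :: "'b set" and w :: "'b \<Rightarrow> 'a" and g :: "'x \<Rightarrow> 'b"
      where E: "finite E" and norm_f: "(norm f)\<^sup>2 = (\<Sum>e\<in>E. (norm (w e))\<^sup>2)"
      and norm_g: "\<And>x. (norm (g x))\<^sup>2 = (\<Sum>e\<in>E. (cmod (cinner (w e) (F1 x)))\<^sup>2)"
      and tonelli: "(\<integral>\<^sup>+z. ennreal ((cmod (cinner f (tensor_map t F1 F2 z)))\<^sup>2) \<partial>(M1 \<Otimes>\<^sub>M M2))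
        = (\<integral>\<^sup>+x. \<integral>\<^sup>+y. ennreal ((cmod (cinner (g x) (F2 y)))\<^sup>2) \<partial>M2 \<partial>M1)"
      by (rule tensor_frame_iterated_integral[OF t M2 meas f]) (rule that)
    have outer: "(\<integral>\<^sup>+x. ennreal (C * (norm (g x))\<^sup>2) \<partial>M1)
        = (\<Sum>e\<in>E. ennreal C * (\<integral>\<^sup>+x. ennreal ((cmod (cinner (w e) (F1 x)))\<^sup>2) \<partial>M1))"
      if "C \<ge> 0" for C
      unfolding norm_g by (rule nn_integral_weighted_sum[OF that E]) simp_all
    have total: "ennreal (C * D * (norm f)\<^sup>2) = (\<Sum>e\<in>E. ennreal C * ennreal (D * (norm (w e))\<^sup>2))"
      if "C \<ge> 0" "D \<ge> 0" for C D
      using that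
      by (simp add: norm_f ennreal_mult[symmetric] sum_distrib_left mult.assoc)
    have "ennreal (A2 * A1 * (norm f)\<^sup>2)
        \<le> (\<Sum>e\<in>E. ennreal A2 * (\<integral>\<^sup>+x. ennreal ((cmod (cinner (w e) (F1 x)))\<^sup>2) \<partial>M1))"
      using 1(1) 2(1) by (subst total) (auto intro!: sum_mono mult_left_mono 1(3))
    also have "\<dots> = (\<integral>\<^sup>+x. ennreal (A2 * (norm (g x))\<^sup>2) \<partial>M1)"
      using 2(1) by (simp add: outer)
    also have "\<dots> \<le> (\<integral>\<^sup>+x. \<integral>\<^sup>+y. ennreal ((cmod (cinner (g x) (F2 y)))\<^sup>2) \<partial>M2 \<partial>M1)"
      by (intro nn_integral_mono 2(3))
    finally show "ennreal (A2 * A1 * (norm f)\<^sup>2)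
        \<le> (\<integral>\<^sup>+z. ennreal ((cmod (cinner f (tensor_map t F1 F2 z)))\<^sup>2) \<partial>(M1 \<Otimes>\<^sub>M M2))"
      unfolding tonelli .
    have "(\<integral>\<^sup>+x. \<integral>\<^sup>+y. ennreal ((cmod (cinner (g x) (F2 y)))\<^sup>2) \<partial>M2 \<partial>M1)
        \<le> (\<integral>\<^sup>+x. ennreal (B2 * (norm (g x))\<^sup>2) \<partial>M1)"
      by (intro nn_integral_mono 2(4))
    also have "\<dots> = (\<Sum>e\<in>E. ennreal B2 * (\<integral>\<^sup>+x. ennreal ((cmod (cinner (w e) (F1 x)))\<^sup>2) \<partial>M1))"
      by (rule outer[OF 2(2)])
    also have "\<dots> \<le> ennreal (B2 * B1 * (norm f)\<^sup>2)"
      using 1(2) 2(2) by (subst total) (auto intro!: sum_mono mult_left_mono 1(4))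
    finally show "(\<integral>\<^sup>+z. ennreal ((cmod (cinner f (tensor_map t F1 F2 z)))\<^sup>2) \<partial>(M1 \<Otimes>\<^sub>M M2))
        \<le> ennreal (B2 * B1 * (norm f)\<^sup>2)"
      unfolding tonelli .
  qed
qed

text \<open>Paired with an elementary tensor, the frame operator applied to an elementary tensor is a
  double integral with separated variables; by Fubini it is the product of the corresponding
  expressions for the two factors.\<close>

lemma frame_op_tensor:
  fixes t :: "'a::chilbert_space \<Rightarrow> 'b::chilbert_space \<Rightarrow> 'c::chilbert_space"
  assumes t: "hilbert_tensor t" and M1: "sigma_finite_measure M1" and M2: "sigma_finite_measure M2"
    and F1: "bessel_mapping M1 F1" and F2: "bessel_mapping M2 F2"
    and F: "bessel_mapping (M1 \<Otimes>\<^sub>M M2) (tensor_map t F1 F2)"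
  shows "frame_op (M1 \<Otimes>\<^sub>M M2) (tensor_map t F1 F2) (t u v)
    = t (frame_op M1 F1 u) (frame_op M2 F2 v)"
proof (rule tensor_eqI[OF t])
  fix u' v'
  interpret pair_sigma_finite M1 M2
    using M1 M2 by (simp add: pair_sigma_finite_def)
  define a where "a x = cinner u (F1 x) * cnj (cinner u' (F1 x))" for x
  define b where "b y = cinner v (F2 y) * cnj (cinner v' (F2 y))" for y
  have ab: "cinner (t u v) (tensor_map t F1 F2 z) * cnj (cinner (t u' v') (tensor_map t F1 F2 z))
      = a (fst z) * b (snd z)" for z
    by (simp add: cinner_tensor_map[OF t] a_def b_def mult_ac)
  have "integrable (M1 \<Otimes>\<^sub>M M2) (\<lambda>z. a (fst z) * b (snd z))"
    unfolding ab[symmetric]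
    by (rule square_integrable_mult_cnj[OF bessel_square_integrable[OF F] bessel_square_integrable[OF F]])
  then have "(\<integral>z. a (fst z) * b (snd z) \<partial>(M1 \<Otimes>\<^sub>M M2)) = (\<integral>x. \<integral>y. a x * b y \<partial>M2 \<partial>M1)"
    by (subst integral_fst'[symmetric]) (simp_all only: fst_conv snd_conv)
  also have "\<dots> = (\<integral>x. a x \<partial>M1) * (\<integral>y. b y \<partial>M2)"
    by (simp only: integral_mult_right_zero integral_mult_left_zero)
  also have "\<dots> = cinner (t (frame_op M1 F1 u) (frame_op M2 F2 v)) (t u' v')"
    unfolding cinner_tensor[OF t] cinner_frame_op[OF F1] cinner_frame_op[OF F2] a_def b_def ..
  finally show "cinner (frame_op (M1 \<Otimes>\<^sub>M M2) (tensor_map t F1 F2) (t u v)) (t u' v')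
      = cinner (t (frame_op M1 F1 u) (frame_op M2 F2 v)) (t u' v')"
    unfolding cinner_frame_op[OF F] ab .
qed

text \<open>Surjectivity of the frame operators of \<open>F1\<close> and \<open>F2\<close> makes the values of \<open>inv\<close> genuine
  preimages; their tensor is then mapped to \<open>F1 x \<otimes> F2 y\<close>, and injectivity of the third frame
  operator identifies it as the value of its \<open>inv\<close>.\<close>

lemma canonical_dual_tensor:
  fixes t :: "'a::chilbert_space \<Rightarrow> 'b::chilbert_space \<Rightarrow> 'c::chilbert_space"
  assumes t: "hilbert_tensor t" and M1: "sigma_finite_measure M1" and M2: "sigma_finite_measure M2"
    and F1: "continuous_frame (M1 :: 'x measure) F1" and F2: "continuous_frame (M2 :: 'y measure) F2"
  shows "canonical_dual (M1 \<Otimes>\<^sub>M M2) (tensor_map t F1 F2)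
    = tensor_map t (canonical_dual M1 F1) (canonical_dual M2 F2)"
proof
  fix z :: "'x \<times> 'y"
  let ?F = "tensor_map t F1 F2" and ?x = "fst z" and ?y = "snd z"
  have F: "continuous_frame (M1 \<Otimes>\<^sub>M M2) ?F"
    by (rule continuous_frame_tensor_map[OF t M2 F1 F2])
  note bij = frame_op_bij[OF F1] frame_op_bij[OF F2] frame_op_bij[OF F]
  have "frame_op (M1 \<Otimes>\<^sub>M M2) ?F (t (canonical_dual M1 F1 ?x) (canonical_dual M2 F2 ?y))
      = t (F1 ?x) (F2 ?y)"
    using bij(1,2)
    by (simp add: frame_op_tensor[OF t M1 M2 F1[THEN continuous_frame_bessel]
          F2[THEN continuous_frame_bessel] F[THEN continuous_frame_bessel]]
        canonical_dual_def surj_f_inv_f bij_is_surj)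
  then have "inv (frame_op (M1 \<Otimes>\<^sub>M M2) ?F) (t (F1 ?x) (F2 ?y))
      = t (canonical_dual M1 F1 ?x) (canonical_dual M2 F2 ?y)"
    by (rule inv_f_eq[OF bij_is_inj[OF bij(3)]])
  then show "canonical_dual (M1 \<Otimes>\<^sub>M M2) ?F z
      = tensor_map t (canonical_dual M1 F1) (canonical_dual M2 F2) z"
    by (simp add: canonical_dual_def tensor_map_def case_prod_unfold)
qed

section \<open>Frame operators and canonical duals of tensor products\<close>

theorem theorem3p6:
  fixes M1 :: "'x measure" and M2 :: "'y measure"
    and tensor :: "'h1::chilbert_space \<Rightarrow> 'h2::chilbert_space \<Rightarrow> 'h::chilbert_space"
    and M :: "('x \<times> 'y) measure"
  assumes "separable_space (euclidean :: 'h1 topology)" and "separable_space (euclidean :: 'h2 topology)"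
    and "hilbert_tensor tensor"
    and "sigma_finite_measure M1" and "sigma_finite_measure M2"
    and "M = M1 \<Otimes>\<^sub>M M2"
  shows
    "(\<forall>F :: 'x \<times> 'y \<Rightarrow> 'h. bessel_mapping M F \<longrightarrow>
        (\<forall>\<phi>. square_integrable M \<phi> \<longrightarrow>
           (\<exists>!h. has_weak_integral M (\<lambda>x. \<phi> x *\<^sub>C F x) h) \<and>
           has_weak_integral M (\<lambda>x. \<phi> x *\<^sub>C F x)
             (synthesis_op M F (L2_class M \<phi>))) \<and>
        L2_bounded_clinear M (synthesis_op M F) \<and>
        is_L2_adjoint M (synthesis_op M F) (analysis_op M F) \<and>
        (\<forall>f. analysis_op M F f =
           L2_class M (\<lambda>x. cinner f (F x)))) \<and>
     (\<forall>(F1 :: 'x \<Rightarrow> 'h1) (F2 :: 'y \<Rightarrow> 'h2).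
        continuous_frame M1 F1 \<and> continuous_frame M2 F2 \<longrightarrow>
        continuous_frame M (tensor_map tensor F1 F2) \<and>
        (\<forall>f1 f2.
           analysis_op M (tensor_map tensor F1 F2) (tensor f1 f2) =
           L2_class M (\<lambda>(x1, x2). cinner f1 (F1 x1) * cinner f2 (F2 x2))) \<and>
        is_tensor_op tensor (frame_op M1 F1) (frame_op M2 F2)
          (frame_op M (tensor_map tensor F1 F2)) \<and>
        frame_op M (tensor_map tensor F1 F2) =
          tensor_op tensor (frame_op M1 F1) (frame_op M2 F2) \<and>
        canonical_dual M (tensor_map tensor F1 F2) =
          tensor_map tensor (\<lambda>x1. inv (frame_op M1 F1) (F1 x1))
            (\<lambda>x2. inv (frame_op M2 F2) (F2 x2)))"
proof (intro conjI allI impI)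
  have M: "M = M1 \<Otimes>\<^sub>M M2" and t: "hilbert_tensor tensor"
    and M1: "sigma_finite_measure M1" and M2: "sigma_finite_measure M2"
    by fact+
  {
    fix F :: "'x \<times> 'y \<Rightarrow> 'h"
    assume F: "bessel_mapping M F"
    show "\<exists>!h. has_weak_integral M (\<lambda>x. \<phi> x *\<^sub>C F x) h" if "square_integrable M \<phi>" for \<phi>
      using bessel_weak_integral_exists[OF F that] has_weak_integral_unique by blast
    show "has_weak_integral M (\<lambda>x. \<phi> x *\<^sub>C F x) (synthesis_op M F (L2_class M \<phi>))"
      if "square_integrable M \<phi>" for \<phi>
      by (rule synthesis_op_weak_integral[OF F that])
    show "L2_bounded_clinear M (synthesis_op M F)"
      by (rule synthesis_op_bounded_clinear[OF F])
    show "is_L2_adjoint M (synthesis_op M F) (analysis_op M F)"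
      unfolding analysis_op_eq[OF F] by (rule synthesis_op_adjoint[OF F])
    show "analysis_op M F f = L2_class M (\<lambda>x. cinner f (F x))" for f
      by (simp only: analysis_op_eq[OF F])
  next
    fix F1 :: "'x \<Rightarrow> 'h1" and F2 :: "'y \<Rightarrow> 'h2"
    assume frames: "continuous_frame M1 F1 \<and> continuous_frame M2 F2"
    then have F1: "continuous_frame M1 F1" and F2: "continuous_frame M2 F2"
      by auto
    let ?F = "tensor_map tensor F1 F2"
    show F: "continuous_frame M ?F"
      unfolding M by (rule continuous_frame_tensor_map[OF t M2 F1 F2])
    note bessel = F1[THEN continuous_frame_bessel] F2[THEN continuous_frame_bessel]
      F[THEN continuous_frame_bessel]
    show "analysis_op M ?F (tensor f1 f2)
        = L2_class M (\<lambda>(x1, x2). cinner f1 (F1 x1) * cinner f2 (F2 x2))" for f1 f2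
      unfolding analysis_op_eq[OF bessel(3)] cinner_tensor_map[OF t] case_prod_unfold ..
    show S: "is_tensor_op tensor (frame_op M1 F1) (frame_op M2 F2) (frame_op M ?F)"
      using frame_op_bounded_clinear[OF bessel(3)] bessel
      by (simp add: is_tensor_op_def M frame_op_tensor[OF t M1 M2])
    show "frame_op M ?F = tensor_op tensor (frame_op M1 F1) (frame_op M2 F2)"
      by (rule tensor_op_eqI[OF t S, symmetric])
    show "canonical_dual M ?F = tensor_map tensor (\<lambda>x1. inv (frame_op M1 F1) (F1 x1))
        (\<lambda>x2. inv (frame_op M2 F2) (F2 x2))"
      using canonical_dual_tensor[OF t M1 M2 F1 F2] by (simp only: M canonical_dual_def)
  }
qed

end
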